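(* There is an absolute constant $c>0$ such that for every $n\ge 3$ and every $3$-uniform hypergraph $H$ on $n$ vertices with at least one hyperedge, $Q(f_H) \ge c\, n^{4/5}$.
   Context: For a fixed $3$-uniform hypergraph $H$ on vertex set $[n]$, $f_H:\{0,1\}^{\binom{n}{3}}\to\{0,1\}$ takes as input a $3$-uniform hypergraph $G$ on $[n]$, given by the $\binom n3$ hyperedge-indicator bits (one per $3$-element subset of $[n]$), and $f_H(G)=1$ iff $H$ is isomorphic to a (not necessarily induced) subhypergraph of $G$, i.e. there is a bijection $\pi:[n]\to[n]$ mapping every hyperedge of $H$ to a hyperedge of $G$. $Q(f)$ denotes the bounded-error (success probability at least $2/3$) quantum query complexity of a Boolean function $f$. *)

theory Defs
  imports Complex_Main
begin

text \<open>A Boolean function f is given on inputs x : 'i \<Rightarrow> bool indexed by a finite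
set I of input positions (values outside I are fixed to False).
The state space of an algorithm with workspace dimension d has orthonormal basis
(q, w) with q \<in> {None} \<union> Some ` I (the query register; None = null query) and
w < d (workspace).  The query operator is the standard phase oracle
O_x |Some i, w> = (-1)^(x i) |Some i, w>,  O_x |None, w> = |None, w>.
An algorithm making T queries is a list of T+1 unitaries U_0,...,U_T; the final
state is U_T O_x U_(T-1) ... O_x U_0 |None,0>, and the output bit is the parity
of the workspace index w measured in the computational basis.\<close>

definition qbasis :: "'i set \<Rightarrow> nat \<Rightarrow> ('i option \<times> nat) set" where
  "qbasis I d = (insert None (Some ` I)) \<times> {..<d}"

definition unitary_on :: "'b set \<Rightarrow> ('b \<Rightarrow> 'b \<Rightarrow> complex) \<Rightarrow> bool" where
  "unitary_on B U \<longleftrightarrow>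
     (\<forall>i\<in>B. \<forall>j\<in>B. (\<Sum>k\<in>B. cnj (U k i) * U k j) = (if i = j then 1 else 0))"

definition apply_op :: "'b set \<Rightarrow> ('b \<Rightarrow> 'b \<Rightarrow> complex) \<Rightarrow> ('b \<Rightarrow> complex) \<Rightarrow> ('b \<Rightarrow> complex)" where
  "apply_op B U v = (\<lambda>k. \<Sum>j\<in>B. U k j * v j)"

definition query_op :: "('i \<Rightarrow> bool) \<Rightarrow> ('i option \<times> nat \<Rightarrow> complex) \<Rightarrow> ('i option \<times> nat \<Rightarrow> complex)" where
  "query_op x v = (\<lambda>(q, w). (case q of None \<Rightarrow> 1 | Some i \<Rightarrow> (if x i then -1 else 1)) * v (q, w))"

definition init_state :: "'i option \<times> nat \<Rightarrow> complex" where
  "init_state = (\<lambda>b. if b = (None, 0) then 1 else 0)"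

fun run_alg :: "('i option \<times> nat) set \<Rightarrow> ('i \<Rightarrow> bool) \<Rightarrow>
    ('i option \<times> nat \<Rightarrow> 'i option \<times> nat \<Rightarrow> complex) list \<Rightarrow> ('i option \<times> nat \<Rightarrow> complex)" where
  "run_alg B x [] = init_state"
| "run_alg B x (U0 # Us) =
     foldl (\<lambda>v U. apply_op B U (query_op x v)) (apply_op B U0 init_state) Us"

definition inputs :: "'i set \<Rightarrow> ('i \<Rightarrow> bool) set" where
  "inputs I = {x. \<forall>i. i \<notin> I \<longrightarrow> x i = False}"

definition out_prob :: "'i set \<Rightarrow> nat \<Rightarrow> ('i \<Rightarrow> bool) \<Rightarrow>
    ('i option \<times> nat \<Rightarrow> 'i option \<times> nat \<Rightarrow> complex) list \<Rightarrow> bool \<Rightarrow> real" where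
  "out_prob I d x Us b =
     (\<Sum>s\<in>{s \<in> qbasis I d. odd (snd s) = b}. (cmod (run_alg (qbasis I d) x Us s))\<^sup>2)"

definition computes_bounded :: "'i set \<Rightarrow> (('i \<Rightarrow> bool) \<Rightarrow> bool) \<Rightarrow> nat \<Rightarrow> bool" where
  "computes_bounded I f T \<longleftrightarrow>
     (\<exists>d Us. d \<ge> 1 \<and> length Us = Suc T \<and> (\<forall>U\<in>set Us. unitary_on (qbasis I d) U) \<and>
        (\<forall>x\<in>inputs I. out_prob I d x Us (f x) \<ge> 2/3))"

definition Q :: "'i set \<Rightarrow> (('i \<Rightarrow> bool) \<Rightarrow> bool) \<Rightarrow> nat" where
  "Q I f = (LEAST T. computes_bounded I f T)"

definition triples :: "nat \<Rightarrow> nat set set" where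
  "triples n = {e. e \<subseteq> {..<n} \<and> card e = 3}"

text \<open>f_H(G) = 1 iff some bijection of [n] maps every hyperedge of H to a hyperedge of G.
The input G is given by its indicator bits x e, e \<in> triples n.\<close>
definition f_H :: "nat \<Rightarrow> nat set set \<Rightarrow> (nat set \<Rightarrow> bool) \<Rightarrow> bool" where
  "f_H n H x \<longleftrightarrow> (\<exists>\<pi>. bij_betw \<pi> {..<n} {..<n} \<and> (\<forall>e\<in>H. x (\<pi> ` e)))"

end

theory Submission
  imports Defs "HOL-Combinatorics.Permutations"
begin

text \<open>The adversary method even gives \<open>Q (f_H) \<ge> n / 1280\<close>. Let \<open>S\<close> be a smallest vertex
  cover of \<open>H\<close>. If \<open>H\<close> has \<open>\<Omega>(n\<^sup>2)\<close> edges, all of them are sensitive at the input \<open>H\<close>.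

  Suppose that \<open>H\<close> has fewer edges and \<open>S\<close> has more than \<open>n / 2\<close> vertices. For an independent set \<open>W\<close>
  call a vertex outside blocked if it forms an edge with two vertices of \<open>W\<close>. Every vertex outside a
  maximal independent set is blocked, and extending \<open>W\<close> by vertices of low degree blocks few vertices
  at a time; so for some size of \<open>W\<close> the least possible number of blocked vertices lies between \<open>n / 8\<close>
  and \<open>n / 4\<close>. Fix a minimising \<open>W\<close> and consider inputs with no edge inside \<open>W\<close> and all edges with at
  least two vertices outside \<open>W\<close>. Each outside vertex carries a row, its set of edges with two
  vertices of \<open>W\<close>. Rows may be permuted freely, but emptying a nonempty one destroys the copy of
  \<open>H\<close> by minimality. Moving linearly many nonempty rows among linearly many empty places gives \<open>\<Omega>(n)\<close>.

  If \<open>S\<close> has at most \<open>n / 2\<close> vertices, make all triples meeting \<open>D = S - {c}\<close> present and argue in the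
  same way with the link graph of \<open>c\<close> outside \<open>S\<close>. This works unless such a link has an independent
  set of at least half of its vertices; then the triples missing from any maximal negative input
  have linear degree at every vertex outside \<open>D\<close>, so that input has quadratic sensitivity.\<close>

subsection \<open>The adversary method\<close>

definition inner_on :: "'b set \<Rightarrow> ('b \<Rightarrow> complex) \<Rightarrow> ('b \<Rightarrow> complex) \<Rightarrow> complex" where
  "inner_on B v w = (\<Sum>b\<in>B. cnj (v b) * w b)"

definition mass_on :: "'b set \<Rightarrow> ('b \<Rightarrow> complex) \<Rightarrow> real" where
  "mass_on B v = (\<Sum>b\<in>B. (cmod (v b))\<^sup>2)"

lemma inner_on_self: "inner_on B v v = of_real (mass_on B v)"
proof -
  have "cnj (v b) * v b = of_real ((cmod (v b))\<^sup>2)" for b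
    using complex_norm_square[of "v b"] by (simp add: mult.commute)
  then show ?thesis
    unfolding inner_on_def mass_on_def by simp
qed

lemma finite_qbasis: "finite I \<Longrightarrow> finite (qbasis I d)"
  unfolding qbasis_def by simp

lemma inner_on_unitary:
  assumes "finite B" and U: "unitary_on B U"
  shows "inner_on B (apply_op B U v) (apply_op B U w) = inner_on B v w"
proof -
  have "inner_on B (apply_op B U v) (apply_op B U w)
      = (\<Sum>k\<in>B. \<Sum>i\<in>B. \<Sum>j\<in>B. (cnj (v i) * w j) * (cnj (U k i) * U k j))"
    unfolding inner_on_def apply_op_def cnj_sum sum_product
    by (intro sum.cong refl) simp
  also have "\<dots> = (\<Sum>i\<in>B. \<Sum>k\<in>B. \<Sum>j\<in>B. (cnj (v i) * w j) * (cnj (U k i) * U k j))"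
    by (rule sum.swap)
  also have "\<dots> = (\<Sum>i\<in>B. \<Sum>j\<in>B. \<Sum>k\<in>B. (cnj (v i) * w j) * (cnj (U k i) * U k j))"
    by (intro sum.cong refl sum.swap)
  also have "\<dots> = (\<Sum>i\<in>B. \<Sum>j\<in>B. (cnj (v i) * w j) * (if i = j then 1 else 0))"
    using U unfolding unitary_on_def by (intro sum.cong refl) (simp flip: sum_distrib_left)
  also have "\<dots> = inner_on B v w"
    unfolding inner_on_def using assms(1) by (simp add: if_distrib cong: if_cong)
  finally show ?thesis .
qed

lemma mass_on_unitary:
  assumes "finite B" and "unitary_on B U"
  shows "mass_on B (apply_op B U v) = mass_on B v"
  using inner_on_unitary[OF assms, of v v] unfolding inner_on_self by simp

lemma mass_on_query: "mass_on B (query_op x v) = mass_on B v"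
  unfolding mass_on_def query_op_def
  by (intro sum.cong refl) (auto simp: norm_mult split: prod.split option.split)

lemma mass_on_init: 
  assumes "finite I" "d \<ge> 1"
  shows "mass_on (qbasis I d) init_state = 1"
proof -
  have "mass_on (qbasis I d) init_state = (\<Sum>b\<in>qbasis I d. if b = (None, 0) then 1 else 0)"
    unfolding mass_on_def init_state_def by (intro sum.cong refl) auto
  also have "\<dots> = 1"
    using assms finite_qbasis[of I d] by (simp add: qbasis_def)
  finally show ?thesis .
qed

lemma run_alg_snoc:
  "Us \<noteq> [] \<Longrightarrow> run_alg B x (Us @ [U]) = apply_op B U (query_op x (run_alg B x Us))"
  by (cases Us) auto

lemma mass_on_run:
  assumes "finite I" "d \<ge> 1" "Us \<noteq> []" "\<forall>U\<in>set Us. unitary_on (qbasis I d) U"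
  shows "mass_on (qbasis I d) (run_alg (qbasis I d) x Us) = 1"
  using assms(3,4)
proof (induction Us rule: rev_nonempty_induct)
  case (single U)
  then show ?case
    using assms by (simp add: mass_on_unitary finite_qbasis mass_on_init)
next
  case (snoc U Us)
  then show ?case
    using assms by (simp add: run_alg_snoc mass_on_unitary finite_qbasis mass_on_query)
qed

section \<open>The effect of one query on the overlap of two runs\<close>

definition queries_differ :: "('i \<Rightarrow> bool) \<Rightarrow> ('i \<Rightarrow> bool) \<Rightarrow> 'i option \<times> nat \<Rightarrow> bool" where
  "queries_differ x y b \<longleftrightarrow> (\<exists>i. fst b = Some i \<and> x i \<noteq> y i)"

lemma two_mult_le_weighted_squares:
  fixes a p q :: real
  assumes "a > 0"
  shows "2 * (p * q) \<le> a * p\<^sup>2 + q\<^sup>2 / a"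
proof -
  have "0 \<le> (a * p - q)\<^sup>2 / a" using assms by simp
  also have "\<dots> = a * p\<^sup>2 + q\<^sup>2 / a - 2 * (p * q)"
    using assms by (simp add: field_simps power2_eq_square)
  finally show ?thesis by simp
qed

text \<open>Where the two oracles give different phases, the term of the inner product changes sign
  and hence by twice itself; all other terms stay. The weight \<open>a\<close> splits the product of
  the two amplitudes, so that the loss is charged to each state separately.\<close>

lemma inner_on_query_loss:
  assumes "finite B" "a > 0"
  shows "cmod (inner_on B v w) \<le> cmod (inner_on B (query_op x v) (query_op y w))
    + (\<Sum>b\<in>B. of_bool (queries_differ x y b) * (a * (cmod (v b))\<^sup>2 + (cmod (w b))\<^sup>2 / a))"
proof -
  have eq: "cnj (v b) * w b - cnj (query_op x v b) * query_op y w b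
      = of_bool (queries_differ x y b) * (2 * (cnj (v b) * w b))" for b
    by (cases b) (auto simp: query_op_def queries_differ_def split: option.split)
  have "inner_on B v w - inner_on B (query_op x v) (query_op y w)
      = (\<Sum>b\<in>B. of_bool (queries_differ x y b) * (2 * (cnj (v b) * w b)))"
    unfolding inner_on_def by (simp add: eq flip: sum_subtractf)
  also have "cmod \<dots> \<le> (\<Sum>b\<in>B. of_bool (queries_differ x y b) * (2 * (cmod (v b) * cmod (w b))))"
    by (rule sum_norm_le) (simp add: norm_mult)
  also have "\<dots> \<le> (\<Sum>b\<in>B. of_bool (queries_differ x y b) *
      (a * (cmod (v b))\<^sup>2 + (cmod (w b))\<^sup>2 / a))"
    by (intro sum_mono mult_left_mono two_mult_le_weighted_squares assms) auto
  finally show ?thesis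
    using norm_triangle_ineq2[of "inner_on B v w" "inner_on B (query_op x v) (query_op y w)"] by linarith
qed

text \<open>The constant 7/10 approximates the optimal weight \<open>1 / sqrt 2\<close>, for which the bound
  would be \<open>2 * sqrt 2 / 3\<close>.\<close>

lemma inner_on_distinguished_le:
  assumes "finite B" "mass_on B v = 1" "mass_on B w = 1" "P \<inter> P' = {}" "P \<union> P' = B"
    and "mass_on P v \<ge> 2/3" "mass_on P' w \<ge> 2/3"
  shows "cmod (inner_on B v w) \<le> 19/20"
proof -
  have fin: "finite P" "finite P'" using assms by (auto intro: finite_subset)
  have split: "mass_on B u = mass_on P u + mass_on P' u" for u
    unfolding mass_on_def using fin assms(4,5) by (metis sum.union_disjoint)
  have bound: "2 * (\<Sum>b\<in>S. cmod (p b) * cmod (q b)) \<le> 7/10 * mass_on S p + 10/7 * mass_on S q"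
    for S and p q :: "'a \<Rightarrow> complex"
  proof -
    have "2 * (\<Sum>b\<in>S. cmod (p b) * cmod (q b))
        \<le> (\<Sum>b\<in>S. 7/10 * (cmod (p b))\<^sup>2 + (cmod (q b))\<^sup>2 / (7/10))"
      unfolding sum_distrib_left by (intro sum_mono two_mult_le_weighted_squares) simp
    then show ?thesis
      by (simp add: mass_on_def sum.distrib sum_divide_distrib sum_distrib_left mult.commute)
  qed
  have "cmod (inner_on B v w) \<le> (\<Sum>b\<in>B. cmod (v b) * cmod (w b))"
    unfolding inner_on_def by (rule sum_norm_le) (simp add: norm_mult)
  also have "\<dots> = (\<Sum>b\<in>P. cmod (v b) * cmod (w b)) + (\<Sum>b\<in>P'. cmod (w b) * cmod (v b))"
    using fin assms(4,5) by (simp add: mult.commute sum.union_disjoint flip: assms(5))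
  \<comment> \<open>On each of \<open>P\<close> and \<open>P'\<close> the state of mass at least 2/3
    gets weight 7/10 and the other, of mass at most 1/3, gets 10/7. Twice the overlap is thus at
    most 2 * (7/10 * 2/3 + 10/7 * 1/3) = 66/35.\<close>
  finally show ?thesis
    using bound[where S = P and p = v and q = w] bound[where S = P' and p = w and q = v] split[of v] split[of w] assms by linarith
qed

lemma sum_of_bool_card:
  "finite A \<Longrightarrow> (\<Sum>k\<in>A. of_bool (P k)) = (of_nat (card {k\<in>A. P k}) :: real)"
  by (simp add: of_bool_def sum.If_cases Int_def)

text \<open>Ambainis' adversary argument. The families \<open>x\<close> and \<open>y\<close> may repeat inputs, and \<open>a\<close> is the
  weight of the two families in the estimate of the progress made by one query.\<close>

theorem adversary_bound:
  fixes J1 :: "'j set" and J2 :: "'k set" and a :: real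
  assumes I: "finite I" and J: "finite J1" "finite J2" and a: "a > 0"
    and comp: "computes_bounded I f T"
    and xin: "\<And>j. j \<in> J1 \<Longrightarrow> x j \<in> inputs I" and yin: "\<And>k. k \<in> J2 \<Longrightarrow> y k \<in> inputs I"
    and neq: "\<And>j k. j \<in> J1 \<Longrightarrow> k \<in> J2 \<Longrightarrow> r j k \<Longrightarrow> f (x j) \<noteq> f (y k)"
    and l1: "\<And>j i. j \<in> J1 \<Longrightarrow> i \<in> I \<Longrightarrow> card {k\<in>J2. r j k \<and> x j i \<noteq> y k i} \<le> l1"
    and l2: "\<And>k i. k \<in> J2 \<Longrightarrow> i \<in> I \<Longrightarrow> card {j\<in>J1. r j k \<and> x j i \<noteq> y k i} \<le> l2"
  shows "(\<Sum>j\<in>J1. real (card {k\<in>J2. r j k})) / 20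
      \<le> T * (a * l1 * card J1 + l2 * card J2 / a)"
proof -
  from comp obtain d Us where d: "d \<ge> 1" and len: "length Us = Suc T"
    and uni: "\<forall>U\<in>set Us. unitary_on (qbasis I d) U"
    and succ: "\<forall>x\<in>inputs I. out_prob I d x Us (f x) \<ge> 2/3"
    unfolding computes_bounded_def by blast
  define B where "B = qbasis I d"
  have B: "finite B" unfolding B_def using I by (rule finite_qbasis)
  \<comment> \<open>Total overlap of the related pairs. It starts at the number \<open>R\<close> of
    pairs, must end below 19/20 of it, and drops by at most \<open>K\<close> per query.\<close>
  define \<Phi> where "\<Phi> Vs = (\<Sum>j\<in>J1. \<Sum>k\<in>J2. of_bool (r j k) *
      cmod (inner_on B (run_alg B (x j) Vs) (run_alg B (y k) Vs)))" for Vs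
  define R where "R = (\<Sum>j\<in>J1. \<Sum>k\<in>J2. of_bool (r j k) :: real)"
  define K where "K = a * l1 * card J1 + l2 * card J2 / a"
  have step: "\<Phi> Vs \<le> \<Phi> (Vs @ [U]) + K"
    if Vs: "Vs \<noteq> []" "\<forall>U\<in>set Vs. unitary_on B U" and U: "unitary_on B U" for Vs U
  proof -
    define v where "v j = run_alg B (x j) Vs" for j
    define w where "w k = run_alg B (y k) Vs" for k
    define D where "D j k b \<longleftrightarrow> r j k \<and> queries_differ (x j) (y k) b" for j k b
    have mv: "mass_on B (v j) = 1" and mw: "mass_on B (w k) = 1" for j k
      using mass_on_run[OF I d Vs(1)] Vs(2) unfolding v_def w_def B_def by auto
    \<comment> \<open>A basis state queries at most one index, so \<open>l1\<close> and
      \<open>l2\<close> bound the number of partners from which it separates an input.\<close>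
    have c1: "real (card {k\<in>J2. D j k b}) \<le> l1" if "j \<in> J1" "b \<in> B" for j b
    proof (cases "fst b")
      case None
      then show ?thesis by (simp add: D_def queries_differ_def)
    next
      case (Some i)
      then have "i \<in> I" using that by (auto simp: B_def qbasis_def)
      then show ?thesis using l1[OF that(1)] Some by (simp add: D_def queries_differ_def)
    qed
    have c2: "real (card {j\<in>J1. D j k b}) \<le> l2" if "k \<in> J2" "b \<in> B" for k b
    proof (cases "fst b")
      case None
      then show ?thesis by (simp add: D_def queries_differ_def)
    next
      case (Some i)
      then have "i \<in> I" using that by (auto simp: B_def qbasis_def)
      then show ?thesis using l2[OF that(1)] Some by (simp add: D_def queries_differ_def)
    qed
    have "\<Phi> Vs \<le> (\<Sum>j\<in>J1. \<Sum>k\<in>J2. of_bool (r j k) *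
        (cmod (inner_on B (query_op (x j) (v j)) (query_op (y k) (w k)))
         + (\<Sum>b\<in>B. of_bool (queries_differ (x j) (y k) b)
              * (a * (cmod (v j b))\<^sup>2 + (cmod (w k b))\<^sup>2 / a))))"
      unfolding \<Phi>_def v_def w_def
      by (intro sum_mono mult_left_mono inner_on_query_loss B a) auto
    also have "\<dots> = \<Phi> (Vs @ [U]) + (\<Sum>j\<in>J1. \<Sum>k\<in>J2. \<Sum>b\<in>B. of_bool (D j k b)
              * (a * (cmod (v j b))\<^sup>2 + (cmod (w k b))\<^sup>2 / a))"
      unfolding \<Phi>_def D_def
      by (simp add: run_alg_snoc Vs inner_on_unitary[OF B U] v_def w_def distrib_left
          sum.distrib sum_distrib_left of_bool_conj mult.assoc)
    also have "(\<Sum>j\<in>J1. \<Sum>k\<in>J2. \<Sum>b\<in>B. of_bool (D j k b)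
              * (a * (cmod (v j b))\<^sup>2 + (cmod (w k b))\<^sup>2 / a))
        = (\<Sum>j\<in>J1. \<Sum>k\<in>J2. \<Sum>b\<in>B. of_bool (D j k b) * (a * (cmod (v j b))\<^sup>2))
        + (\<Sum>j\<in>J1. \<Sum>k\<in>J2. \<Sum>b\<in>B. of_bool (D j k b) * ((cmod (w k b))\<^sup>2 / a))"
      by (simp only: distrib_left sum.distrib)
    \<comment> \<open>With the sum over the partners innermost, \<open>l1\<close> factors out and
      the total mass 1 of each state remains; the other half is treated alike with
      \<open>l2\<close>.\<close>
    also have "(\<Sum>j\<in>J1. \<Sum>k\<in>J2. \<Sum>b\<in>B. of_bool (D j k b) * (a * (cmod (v j b))\<^sup>2))
        = (\<Sum>j\<in>J1. \<Sum>b\<in>B. \<Sum>k\<in>J2. of_bool (D j k b) * (a * (cmod (v j b))\<^sup>2))"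
      by (intro sum.cong refl sum.swap)
    also have "\<dots> = (\<Sum>j\<in>J1. \<Sum>b\<in>B. real (card {k\<in>J2. D j k b}) * (a * (cmod (v j b))\<^sup>2))"
      by (simp only: sum_of_bool_card[OF J(2)] flip: sum_distrib_right)
    also have "\<dots> \<le> (\<Sum>j\<in>J1. \<Sum>b\<in>B. real l1 * (a * (cmod (v j b))\<^sup>2))"
      using a by (intro sum_mono mult_right_mono c1) auto
    also have "\<dots> = (\<Sum>j\<in>J1. real l1 * (a * mass_on B (v j)))"
      unfolding mass_on_def sum_distrib_left ..
    also have "\<dots> = a * l1 * card J1"
      by (simp add: mv)
    also have "(\<Sum>j\<in>J1. \<Sum>k\<in>J2. \<Sum>b\<in>B. of_bool (D j k b) * ((cmod (w k b))\<^sup>2 / a))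
        = (\<Sum>k\<in>J2. \<Sum>j\<in>J1. \<Sum>b\<in>B. of_bool (D j k b) * ((cmod (w k b))\<^sup>2 / a))"
      by (rule sum.swap)
    also have "\<dots> = (\<Sum>k\<in>J2. \<Sum>b\<in>B. \<Sum>j\<in>J1. of_bool (D j k b) * ((cmod (w k b))\<^sup>2 / a))"
      by (intro sum.cong refl sum.swap)
    also have "\<dots> = (\<Sum>k\<in>J2. \<Sum>b\<in>B. real (card {j\<in>J1. D j k b}) * ((cmod (w k b))\<^sup>2 / a))"
      by (simp only: sum_of_bool_card[OF J(1)] flip: sum_distrib_right)
    also have "\<dots> \<le> (\<Sum>k\<in>J2. \<Sum>b\<in>B. real l2 * ((cmod (w k b))\<^sup>2 / a))"
      using a by (intro sum_mono mult_right_mono c2) auto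
    also have "\<dots> = (\<Sum>k\<in>J2. real l2 * (mass_on B (w k) / a))"
      unfolding mass_on_def sum_distrib_left sum_divide_distrib ..
    also have "\<dots> = l2 * card J2 / a"
      by (simp add: mw)
    finally show ?thesis unfolding K_def by simp
  qed
  \<comment> \<open>\<open>length Vs - 1\<close> is the number of queries: the first unitary acts
    before any query.\<close>
  have prog: "R \<le> \<Phi> Vs + real (length Vs - 1) * K"
    if "Vs \<noteq> []" "\<forall>U\<in>set Vs. unitary_on B U" for Vs
    using that
  proof (induction Vs rule: rev_nonempty_induct)
    case (single U)
    have "cmod (inner_on B (run_alg B (x j) [U]) (run_alg B (y k) [U])) = 1" for j k
      unfolding run_alg.simps foldl.simps inner_on_unitary[OF B bspec[OF single list.set_intros(1)]]
      using mass_on_init[OF I d] by (simp add: inner_on_self B_def)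
    then show ?case unfolding \<Phi>_def R_def by simp
  next
    case (snoc U Vs)
    then have "R \<le> \<Phi> Vs + real (length Vs - 1) * K" by simp
    also have "\<dots> \<le> \<Phi> (Vs @ [U]) + (K + real (length Vs - 1) * K)"
      using step[of Vs U] snoc by simp
    also have "K + real (length Vs - 1) * K = real (length Vs) * K"
      using snoc(1) by (cases Vs) (auto simp: algebra_simps)
    finally show ?case by simp
  qed
  have fin: "cmod (inner_on B (run_alg B (x j) Us) (run_alg B (y k) Us)) \<le> 19/20"
    if jk: "j \<in> J1" "k \<in> J2" "r j k" for j k
  proof (rule inner_on_distinguished_le[OF B])
    show "mass_on B (run_alg B (x j) Us) = 1" "mass_on B (run_alg B (y k) Us) = 1"
      using mass_on_run[OF I d _ uni] len unfolding B_def by force+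
    show "mass_on {s\<in>B. odd (snd s) = f (x j)} (run_alg B (x j) Us) \<ge> 2/3"
      "mass_on {s\<in>B. odd (snd s) = f (y k)} (run_alg B (y k) Us) \<ge> 2/3"
      using succ xin[OF jk(1)] yin[OF jk(2)] unfolding out_prob_def mass_on_def B_def by auto
  qed (use neq[OF jk] in auto)
  have "\<Phi> Us \<le> (\<Sum>j\<in>J1. \<Sum>k\<in>J2. of_bool (r j k) * (19/20))"
    unfolding \<Phi>_def by (intro sum_mono) (use fin in auto)
  also have "\<dots> = 19/20 * R"
    unfolding R_def by (simp add: sum_distrib_left sum_distrib_right mult.commute)
  finally have "R \<le> 19/20 * R + real (length Us - 1) * K"
    using prog[of Us] len uni unfolding B_def by fastforce
  then have "R / 20 \<le> real T * K"
    using len by simp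
  moreover have "R = (\<Sum>j\<in>J1. real (card {k\<in>J2. r j k}))"
    unfolding R_def by (simp only: sum_of_bool_card[OF J(2)])
  ultimately show ?thesis
    unfolding K_def by simp
qed

subsection \<open>Existence of an exact algorithm\<close>

text \<open>Lower bounds on \<open>Q\<close> need this: \<open>LEAST\<close> is unspecified if no algorithm exists.\<close>

text \<open>Pairs swapped by the involution \<open>\<tau>\<close> are mixed. The choice \<open>c = 0\<close>, \<open>s = 1\<close> gives the
  permutation \<open>\<tau>\<close>, and \<open>c = s = 1 / sqrt 2\<close> gives Hadamard gates.\<close>

definition two_level :: "('b \<Rightarrow> 'b) \<Rightarrow> ('b \<Rightarrow> real) \<Rightarrow> real \<Rightarrow> real \<Rightarrow> 'b \<Rightarrow> 'b \<Rightarrow> complex" where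
  "two_level \<tau> \<epsilon> c s k j =
     (if \<tau> j = j then (if k = j then 1 else 0)
      else if k = j then of_real (c * \<epsilon> j) else if k = \<tau> j then of_real s else 0)"

lemma two_level_column_sum:
  assumes "finite B" "j \<in> B" "\<tau> j \<in> B"
  shows "(\<Sum>k\<in>B. cnj (two_level \<tau> \<epsilon> c s k j) * g k)
    = (if \<tau> j = j then g j else of_real (c * \<epsilon> j) * g j + of_real s * g (\<tau> j))"
proof -
  have "(\<Sum>k\<in>B. cnj (two_level \<tau> \<epsilon> c s k j) * g k)
      = (\<Sum>k\<in>{j, \<tau> j}. cnj (two_level \<tau> \<epsilon> c s k j) * g k)"
    by (rule sum.mono_neutral_right) (use assms in \<open>auto simp: two_level_def\<close>)
  also have "\<dots> = (if \<tau> j = j then g j else of_real (c * \<epsilon> j) * g j + of_real s * g (\<tau> j))"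
    by (auto simp: two_level_def)
  finally show ?thesis .
qed

text \<open>On a pair swapped by \<open>\<tau>\<close> the block is symmetric with diagonal entries
  \<open>c\<close> and \<open>-c\<close> in some order and off-diagonal entry \<open>s\<close>. The
  opposite signs of \<open>\<epsilon>\<close> make its columns orthogonal, and \<open>cs\<close>
  normalises them.\<close>

lemma unitary_two_level:
  assumes B: "finite B" and \<tau>: "\<And>j. j \<in> B \<Longrightarrow> \<tau> j \<in> B" "\<And>j. j \<in> B \<Longrightarrow> \<tau> (\<tau> j) = j"
    and \<epsilon>: "\<And>j. j \<in> B \<Longrightarrow> \<tau> j \<noteq> j \<Longrightarrow> \<epsilon> (\<tau> j) = - \<epsilon> j" "\<And>j. j \<in> B \<Longrightarrow> \<epsilon> j * \<epsilon> j = 1"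
    and cs: "c * c + s * s = 1"
  shows "unitary_on B (two_level \<tau> \<epsilon> c s)"
  unfolding unitary_on_def
proof (intro ballI)
  fix i j assume ij: "i \<in> B" "j \<in> B"
  have inj: "\<tau> i = \<tau> j \<longleftrightarrow> i = j" "\<tau> i = j \<longleftrightarrow> i = \<tau> j"
    using \<tau>(2)[OF ij(1)] \<tau>(2)[OF ij(2)] by metis+
  have sq: "c * (c * (\<epsilon> j * \<epsilon> j)) + s * s = 1" using \<epsilon>(2)[OF ij(2)] cs by simp
  have "complex_of_real (c * \<epsilon> j) * of_real (c * \<epsilon> j) + of_real s * of_real s
      = of_real (c * (c * (\<epsilon> j * \<epsilon> j)) + s * s)"
    by (simp add: algebra_simps)
  then have one: "complex_of_real (c * \<epsilon> j) * of_real (c * \<epsilon> j) + of_real s * of_real s = 1"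
    unfolding sq by simp
  have col: "(\<Sum>k\<in>B. cnj (two_level \<tau> \<epsilon> c s k i) * two_level \<tau> \<epsilon> c s k j)
      = (if \<tau> i = i then two_level \<tau> \<epsilon> c s i j
         else of_real (c * \<epsilon> i) * two_level \<tau> \<epsilon> c s i j + of_real s * two_level \<tau> \<epsilon> c s (\<tau> i) j)"
    using ij \<tau>(1) by (intro two_level_column_sum B)
  consider "i = j" | "i \<noteq> j" "i = \<tau> j" | "i \<noteq> j" "i \<noteq> \<tau> j"
    by blast
  then show "(\<Sum>k\<in>B. cnj (two_level \<tau> \<epsilon> c s k i) * two_level \<tau> \<epsilon> c s k j) = (if i = j then 1 else 0)"
    unfolding col
  proof cases
    case 1
    then show "(if \<tau> i = i then two_level \<tau> \<epsilon> c s i j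
         else of_real (c * \<epsilon> i) * two_level \<tau> \<epsilon> c s i j + of_real s * two_level \<tau> \<epsilon> c s (\<tau> i) j)
         = (if i = j then 1 else 0)"
      using one by (simp add: two_level_def)
  next
    case 2
    then have "\<tau> j \<noteq> j" by auto
    with 2 show "(if \<tau> i = i then two_level \<tau> \<epsilon> c s i j
         else of_real (c * \<epsilon> i) * two_level \<tau> \<epsilon> c s i j + of_real s * two_level \<tau> \<epsilon> c s (\<tau> i) j)
         = (if i = j then 1 else 0)"
      using \<tau>(2)[OF ij(2)] \<epsilon>(1)[OF ij(2)] by (simp add: two_level_def)
  next
    case 3
    then show "(if \<tau> i = i then two_level \<tau> \<epsilon> c s i j
         else of_real (c * \<epsilon> i) * two_level \<tau> \<epsilon> c s i j + of_real s * two_level \<tau> \<epsilon> c s (\<tau> i) j)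
         = (if i = j then 1 else 0)"
      using inj by (auto simp: two_level_def)
  qed
qed

lemma apply_two_level:
  assumes B: "finite B" and k: "k \<in> B" "\<tau> k \<in> B" and \<tau>: "\<And>j. j \<in> B \<Longrightarrow> \<tau> (\<tau> j) = j"
  shows "apply_op B (two_level \<tau> \<epsilon> c s) v k
    = (if \<tau> k = k then v k else of_real (c * \<epsilon> k) * v k + of_real s * v (\<tau> k))"
proof -
  have *: "two_level \<tau> \<epsilon> c s k j = 0" if "j \<in> B" "j \<noteq> k" "j \<noteq> \<tau> k" for j
    using that \<tau>[OF that(1)] by (auto simp: two_level_def)
  have "apply_op B (two_level \<tau> \<epsilon> c s) v k = (\<Sum>j\<in>{k, \<tau> k}. two_level \<tau> \<epsilon> c s k j * v j)"
    unfolding apply_op_def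
    by (rule sum.mono_neutral_right) (use B k * in auto)
  also have "\<dots> = (if \<tau> k = k then v k else of_real (c * \<epsilon> k) * v k + of_real s * v (\<tau> k))"
    using \<tau>[OF k(1)] by (auto simp: two_level_def)
  finally show ?thesis .
qed

section \<open>Composition of unitaries and the states reachable with \<open>T\<close>
  queries\<close>

definition op_mult :: "'b set \<Rightarrow> ('b \<Rightarrow> 'b \<Rightarrow> complex) \<Rightarrow> ('b \<Rightarrow> 'b \<Rightarrow> complex) \<Rightarrow> 'b \<Rightarrow> 'b \<Rightarrow> complex" where
  "op_mult B V U = (\<lambda>k j. apply_op B V (\<lambda>i. U i j) k)"

lemma unitary_op_mult:
  assumes "finite B" "unitary_on B V" "unitary_on B U"
  shows "unitary_on B (op_mult B V U)"
  using inner_on_unitary[OF assms(1,2)] assms(3)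
  unfolding unitary_on_def op_mult_def inner_on_def by simp

lemma apply_op_mult: "apply_op B (op_mult B V U) v = apply_op B V (apply_op B U v)"
proof
  fix k
  have "apply_op B (op_mult B V U) v k = (\<Sum>j\<in>B. \<Sum>i\<in>B. V k i * (U i j * v j))"
    by (simp add: apply_op_def op_mult_def sum_distrib_right mult.assoc)
  also have "\<dots> = (\<Sum>i\<in>B. \<Sum>j\<in>B. V k i * (U i j * v j))" by (rule sum.swap)
  also have "\<dots> = apply_op B V (apply_op B U v) k"
    by (simp add: apply_op_def sum_distrib_left)
  finally show "apply_op B (op_mult B V U) v k = apply_op B V (apply_op B U v) k" .
qed

lemma apply_op_cong: "(\<And>b. b \<in> B \<Longrightarrow> v b = w b) \<Longrightarrow> apply_op B U v = apply_op B U w"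
  unfolding apply_op_def by (intro ext sum.cong) auto

text \<open>Agreement is demanded on basis states only, since \<open>apply_op\<close> reads no
  amplitude outside them. \<open>Suc T\<close> unitaries enclose \<open>T\<close> queries.\<close>

definition reachable :: "'i set \<Rightarrow> nat \<Rightarrow> nat \<Rightarrow>
    (('i \<Rightarrow> bool) \<Rightarrow> 'i option \<times> nat \<Rightarrow> complex) \<Rightarrow> bool" where
  "reachable I d T v \<longleftrightarrow> (\<exists>Us. length Us = Suc T \<and> (\<forall>U\<in>set Us. unitary_on (qbasis I d) U) \<and>
     (\<forall>x\<in>inputs I. \<forall>b\<in>qbasis I d. run_alg (qbasis I d) x Us b = v x b))"

lemma unitary_id: "finite B \<Longrightarrow> unitary_on B (two_level id (\<lambda>_. 1) 1 0)"
  by (rule unitary_two_level) auto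

lemma apply_id: "finite B \<Longrightarrow> k \<in> B \<Longrightarrow> apply_op B (two_level id (\<lambda>_. 1) 1 0) v k = v k"
  by (subst apply_two_level) auto

lemma reachable_init: "finite I \<Longrightarrow> reachable I d 0 (\<lambda>_. init_state)"
  unfolding reachable_def
  by (intro exI[of _ "[two_level id (\<lambda>_. 1) 1 0]"])
    (auto simp: unitary_id apply_id finite_qbasis)

text \<open>In \<open>run_alg\<close> a unitary follows every query, so the identity is
  appended.\<close>

lemma reachable_query:
  assumes "finite I" "reachable I d T v"
  shows "reachable I d (Suc T) (\<lambda>x. query_op x (v x))"
proof -
  let ?B = "qbasis I d" and ?id = "two_level id (\<lambda>_. 1) 1 0"
  from assms(2) obtain Us where Us: "length Us = Suc T" "\<forall>U\<in>set Us. unitary_on ?B U"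
    "\<forall>x\<in>inputs I. \<forall>b\<in>?B. run_alg ?B x Us b = v x b"
    unfolding reachable_def by blast
  have ne: "Us \<noteq> []" using Us(1) by auto
  have "run_alg ?B x (Us @ [?id]) b = query_op x (v x) b" if "x \<in> inputs I" "b \<in> ?B" for x b
    using that Us(3) assms(1)
    by (cases b) (simp add: run_alg_snoc[OF ne] apply_id finite_qbasis query_op_def)
  then show ?thesis
    unfolding reachable_def using Us assms(1)
    by (intro exI[of _ "Us @ [?id]"]) (auto simp: unitary_id finite_qbasis)
qed

text \<open>\<open>V\<close> is multiplied into the last unitary of the list and so costs no
  query.\<close>

lemma reachable_unitary:
  assumes I: "finite I" and "reachable I d T v" and V: "unitary_on (qbasis I d) V"
    and v': "\<And>x b. x \<in> inputs I \<Longrightarrow> b \<in> qbasis I d \<Longrightarrow> apply_op (qbasis I d) V (v x) b = v' x b"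
  shows "reachable I d T v'"
proof -
  let ?B = "qbasis I d"
  from assms(2) obtain Us where Us: "length Us = Suc T" "\<forall>U\<in>set Us. unitary_on ?B U"
    "\<forall>x\<in>inputs I. \<forall>b\<in>?B. run_alg ?B x Us b = v x b"
    unfolding reachable_def by blast
  obtain Us' U where U: "Us = Us' @ [U]" using Us(1) by (cases Us rule: rev_cases) auto
  have run: "run_alg ?B x (Us' @ [op_mult ?B V U]) = apply_op ?B V (run_alg ?B x Us)" for x
  proof (cases "Us' = []")
    case False
    then show ?thesis by (simp add: U run_alg_snoc apply_op_mult)
  qed (simp add: U apply_op_mult)
  have "run_alg ?B x (Us' @ [op_mult ?B V U]) b = v' x b" if "x \<in> inputs I" "b \<in> ?B" for x b
    unfolding run v'[OF that, symmetric]
    using apply_op_cong[of ?B "run_alg ?B x Us" "v x" V] Us(3) that by simp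
  then show ?thesis
    unfolding reachable_def using Us U V I
    by (intro exI[of _ "Us' @ [op_mult ?B V U]"]) (auto simp: unitary_op_mult finite_qbasis)
qed

definition ket :: "'b \<Rightarrow> 'b \<Rightarrow> complex" where
  "ket b = (\<lambda>b'. if b' = b then 1 else 0)"

lemma reachable_permute:
  fixes \<epsilon> :: "'i option \<times> nat \<Rightarrow> real"
  assumes I: "finite I" and v: "reachable I d T (\<lambda>x. ket (g x))"
    and \<tau>: "\<And>j. j \<in> qbasis I d \<Longrightarrow> \<tau> j \<in> qbasis I d" "\<And>j. \<tau> (\<tau> j) = j"
    and \<epsilon>: "\<And>j. \<tau> j \<noteq> j \<Longrightarrow> \<epsilon> (\<tau> j) = - \<epsilon> j" "\<And>j. \<epsilon> j * \<epsilon> j = 1"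
  shows "reachable I d T (\<lambda>x. ket (\<tau> (g x)))"
proof (rule reachable_unitary[OF I v])
  show "unitary_on (qbasis I d) (two_level \<tau> \<epsilon> 0 1)"
    by (rule unitary_two_level) (use assms finite_qbasis in auto)
  show "apply_op (qbasis I d) (two_level \<tau> \<epsilon> 0 1) (ket (g x)) b = ket (\<tau> (g x)) b"
    if "b \<in> qbasis I d" for x b
  proof -
    have "\<tau> b = g x \<longleftrightarrow> b = \<tau> (g x)" using \<tau>(2) by metis
    with that finite_qbasis[OF I] \<tau> show ?thesis
      by (subst apply_two_level) (auto simp: ket_def)
  qed
qed

text \<open>Interference with the null query: a Hadamard gate on \<open>None\<close> and
  \<open>Some i\<close> creates an equal superposition, the query puts the bit into the relative
  sign, and a second Hadamard gate turns the sign into the content of the query register.\<close>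

lemma reachable_read_bit:
  assumes I: "finite I" and i: "i \<in> I" and v: "reachable I d T (\<lambda>x. ket (None, g x))"
  shows "reachable I d (Suc T) (\<lambda>x. ket (if x i then Some i else None, g x))"
proof -
  let ?B = "qbasis I d"
  define \<tau> where "\<tau> = (\<lambda>(q, w). (if q = None then Some i else if q = Some i then None else q, w :: nat))"
  define \<epsilon> :: "'a option \<times> nat \<Rightarrow> real" where "\<epsilon> = (\<lambda>(q, w). if q = None then 1 else -1)"
  define h :: real where "h = 1 / sqrt 2"
  have h: "h * h + h * h = 1" by (simp add: h_def)
  have hc: "2 * (complex_of_real h * complex_of_real h) = 1"
  proof -
    have "2 * (h * h) = 1" using h by simp
    then show ?thesis by (metis of_real_mult of_real_1 of_real_numeral)
  qed
  have \<tau>: "\<tau> j \<in> ?B" if "j \<in> ?B" for j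
    using that i by (auto simp: \<tau>_def qbasis_def split: if_splits)
  have \<tau>2: "\<tau> (\<tau> j) = j" for j
    by (auto simp: \<tau>_def split: prod.splits if_splits)
  have \<epsilon>: "\<tau> j \<noteq> j \<Longrightarrow> \<epsilon> (\<tau> j) = - \<epsilon> j" "\<epsilon> j * \<epsilon> j = 1" for j
    by (auto simp: \<tau>_def \<epsilon>_def split: prod.splits if_splits)
  have uni: "unitary_on ?B (two_level \<tau> \<epsilon> h h)"
    by (rule unitary_two_level) (use finite_qbasis[OF I] \<tau> \<tau>2 \<epsilon> h in simp_all)
  define v1 where "v1 x b = (if b = (None, g x) \<or> b = (Some i, g x) then complex_of_real h else 0)" for x b
  have "reachable I d T v1"
  proof (rule reachable_unitary[OF I v uni])
    show "apply_op ?B (two_level \<tau> \<epsilon> h h) (ket (None, g x)) b = v1 x b" if "b \<in> ?B" for x b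
      using that finite_qbasis[OF I] \<tau> \<tau>2
      by (subst apply_two_level) (auto simp: ket_def v1_def \<tau>_def \<epsilon>_def split: prod.splits)
  qed
  then have "reachable I d (Suc T) (\<lambda>x. query_op x (v1 x))"
    by (rule reachable_query[OF I])
  then show ?thesis
  proof (rule reachable_unitary[OF I _ uni])
    show "apply_op ?B (two_level \<tau> \<epsilon> h h) (query_op x (v1 x)) b
        = ket (if x i then Some i else None, g x) b" if "b \<in> ?B" for x b
      using that finite_qbasis[OF I] \<tau> \<tau>2 hc
      by (subst apply_two_level)
        (auto simp: ket_def v1_def \<tau>_def \<epsilon>_def query_op_def split: prod.splits option.splits)
  qed
qed

lemma reachable_read_set:
  assumes I: "finite I" and d: "d \<ge> 2 ^ Suc (card I)" and "A \<subseteq> I"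
  shows "\<exists>code. inj_on code (Pow A) \<and> (\<forall>S\<subseteq>A. even (code S) \<and> code S < 2 ^ Suc (card A)) \<and>
    reachable I d (card A) (\<lambda>x. ket (None, code {i\<in>A. x i}))"
  using finite_subset[OF assms(3) I] assms(3)
proof (induction A rule: finite_induct)
  case empty
  then show ?case
    using reachable_init[OF I, of d]
    by (intro exI[of _ "\<lambda>_. 0"]) (auto simp: init_state_def ket_def)
next
  case (insert i A)
  then obtain code where code: "inj_on code (Pow A)"
    "\<And>S. S \<subseteq> A \<Longrightarrow> even (code S)" "\<And>S. S \<subseteq> A \<Longrightarrow> code S < 2 ^ Suc (card A)"
    and reach: "reachable I d (card A) (\<lambda>x. ket (None, code {i\<in>A. x i}))" by auto
  \<comment> \<open>An even number above all codes for \<open>A\<close>; adding it records bit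
    \<open>i\<close> without collisions.\<close>
  define M :: nat where "M = 2 ^ Suc (card A)"
  have iA: "i \<in> I" "i \<notin> A" "card (insert i A) = Suc (card A)" using insert by auto
  have "card (insert i A) \<le> card I" using insert I by (intro card_mono) auto
  then have "(2::nat) ^ Suc (card (insert i A)) \<le> 2 ^ Suc (card I)" by (intro power_increasing) auto
  then have Md: "2 * M \<le> d" using d iA by (simp add: M_def)
  define code' where "code' S = code (S - {i}) + (if i \<in> S then M else 0)" for S
  define \<tau> where "\<tau> = (\<lambda>(q, w). if q = Some i \<and> w < M then (None, w + M)
     else if q = None \<and> M \<le> w \<and> w < 2 * M then (Some i, w - M) else (q, w))"
  define \<epsilon> :: "'a option \<times> nat \<Rightarrow> real" where "\<epsilon> = (\<lambda>(q, w). if q = None then 1 else -1)"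
  have "reachable I d (Suc (card A)) (\<lambda>x. ket (\<tau> (if x i then Some i else None, code {i\<in>A. x i})))"
  proof (rule reachable_permute[OF I reachable_read_bit[OF I iA(1) reach]])
    show "\<tau> j \<in> qbasis I d" if "j \<in> qbasis I d" for j
      using that Md iA by (auto simp: \<tau>_def qbasis_def)
    show "\<tau> (\<tau> j) = j" for j by (auto simp: \<tau>_def split: prod.splits if_splits)
    show "\<epsilon> (\<tau> j) = - \<epsilon> j" if "\<tau> j \<noteq> j" for j
      using that by (auto simp: \<tau>_def \<epsilon>_def split: prod.splits if_splits)
    show "\<epsilon> j * \<epsilon> j = 1" for j by (auto simp: \<epsilon>_def split: prod.splits)
  qed
  moreover have "\<tau> (if x i then Some i else None, code {i\<in>A. x i}) = (None, code' {j\<in>insert i A. x j})" for x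
  proof -
    have "{j\<in>insert i A. x j} - {i} = {j\<in>A. x j}" using iA by auto
    then show ?thesis using code(3)[of "{j\<in>A. x j}"] by (auto simp: \<tau>_def code'_def M_def)
  qed
  moreover have "inj_on code' (Pow (insert i A))"
  proof (rule inj_onI)
    fix S S' assume S: "S \<in> Pow (insert i A)" "S' \<in> Pow (insert i A)" "code' S = code' S'"
    then have sub: "S - {i} \<subseteq> A" "S' - {i} \<subseteq> A" by auto
    have "i \<in> S \<longleftrightarrow> i \<in> S'" and "code (S - {i}) = code (S' - {i})"
      using S(3) code(3)[OF sub(1)] code(3)[OF sub(2)]
      by (auto simp: code'_def M_def split: if_splits)
    moreover from this have "S - {i} = S' - {i}"
      using inj_onD[OF code(1)] sub by blast
    ultimately show "S = S'" by blast
  qed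
  moreover have "even (code' S)" "code' S < 2 ^ Suc (card (insert i A))" if "S \<subseteq> insert i A" for S
  proof -
    have "S - {i} \<subseteq> A" using that by auto
    from code(2,3)[OF this] show "even (code' S)" "code' S < 2 ^ Suc (card (insert i A))"
      by (auto simp: code'_def M_def iA(3))
  qed
  ultimately show ?case using iA(3) by (intro exI[of _ code']) simp
qed

lemma computes_bounded_card:
  assumes I: "finite I"
  shows "computes_bounded I f (card I)"
proof -
  define d :: nat where "d = 2 ^ Suc (card I)"
  obtain code where code: "inj_on code (Pow I)" "\<And>S. S \<subseteq> I \<Longrightarrow> even (code S)"
    and reach: "reachable I d (card I) (\<lambda>x. ket (None, code {i\<in>I. x i}))"
    using reachable_read_set[OF I, of d I] d_def by auto
  \<comment> \<open>Halving is injective on even codes and ignores the lowest bit, so the condition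
    on \<open>w div 2\<close> survives when \<open>\<tau>\<close> toggles that bit.\<close>
  define P where "P m \<longleftrightarrow> (\<exists>S\<subseteq>I. f (\<lambda>i. i \<in> S) \<and> code S div 2 = m)" for m
  define \<tau> where "\<tau> = (\<lambda>(q :: 'a option, w). if q = None \<and> P (w div 2)
     then (None, if even w then Suc w else w - 1) else (q, w))"
  define \<epsilon> :: "'a option \<times> nat \<Rightarrow> real" where "\<epsilon> = (\<lambda>(q, w). if even w then 1 else -1)"
  have flip: "w - Suc 0 < d" "Suc (w - Suc 0) = w" "(w - Suc 0) div 2 = w div 2" if "w < d" "odd w" for w
    using that by (auto elim!: oddE)
  have flip': "Suc w < d" if "w < d" "even w" for w
  proof -
    have "even d" by (simp add: d_def)
    with that show ?thesis by (metis Suc_lessI even_Suc)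
  qed
  have "reachable I d (card I) (\<lambda>x. ket (\<tau> (None, code {i\<in>I. x i})))"
  proof (rule reachable_permute[OF I reach])
    show "\<tau> j \<in> qbasis I d" if "j \<in> qbasis I d" for j
      using that flip flip' by (auto simp: \<tau>_def qbasis_def)
    show "\<tau> (\<tau> j) = j" for j
    proof (cases j)
      case (Pair q w)
      show ?thesis
      proof (cases "even w")
        case False
        then obtain m where "w = 2 * m + 1" by (rule oddE)
        then show ?thesis by (simp add: \<tau>_def Pair)
      qed (simp add: \<tau>_def Pair)
    qed
    show "\<epsilon> (\<tau> j) = - \<epsilon> j" if "\<tau> j \<noteq> j" for j
      using that by (auto simp: \<tau>_def \<epsilon>_def split: prod.splits if_splits)
    show "\<epsilon> j * \<epsilon> j = 1" for j by (auto simp: \<epsilon>_def split: prod.splits)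
  qed
  then obtain Us where Us: "length Us = Suc (card I)" "\<forall>U\<in>set Us. unitary_on (qbasis I d) U"
    "\<forall>x\<in>inputs I. \<forall>b\<in>qbasis I d. run_alg (qbasis I d) x Us b = ket (\<tau> (None, code {i\<in>I. x i})) b"
    unfolding reachable_def by blast
  have "out_prob I d x Us (f x) \<ge> 2/3" if x: "x \<in> inputs I" for x
  proof -
    define S where "S = {i\<in>I. x i}"
    have xS: "x = (\<lambda>i. i \<in> S)" using x unfolding inputs_def S_def by auto
    have SI: "S \<subseteq> I" by (auto simp: S_def)
    have "P (code S div 2) \<longleftrightarrow> f x"
    proof
      assume "P (code S div 2)"
      then obtain S' where S': "S' \<subseteq> I" "f (\<lambda>i. i \<in> S')" "code S' div 2 = code S div 2"
        unfolding P_def by blast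
      then have "code S' = code S"
        using code(2)[OF SI] code(2)[OF S'(1)] by (metis dvd_mult_div_cancel)
      then have "S' = S" using inj_onD[OF code(1)] SI S'(1) by blast
      then show "f x" using S' xS by simp
    qed (use SI xS in \<open>auto simp: P_def\<close>)
    then have \<tau>: "\<tau> (None, code S) = (None, if f x then Suc (code S) else code S)"
      using code(2)[OF SI] by (auto simp: \<tau>_def)
    define b where "b = \<tau> (None, code S)"
    have "odd (snd b) = f x" using code(2)[OF SI] by (simp add: b_def \<tau>)
    moreover have "b \<in> qbasis I d"
    \<comment> \<open>On the basis the final state equals \<open>ket b\<close>; with
      \<open>b\<close> outside the basis its mass would be 0 instead of 1.\<close>
    proof (rule ccontr)
      assume "b \<notin> qbasis I d"
      then have "mass_on (qbasis I d) (run_alg (qbasis I d) x Us) = 0"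
        using Us(3) x by (auto simp: mass_on_def b_def S_def ket_def intro!: sum.neutral)
      then show False
        using mass_on_run[OF I _ _ Us(2), of x] Us(1) by (force simp: d_def)
    qed
    ultimately have "(\<Sum>s\<in>{b}. (cmod (run_alg (qbasis I d) x Us s))\<^sup>2) \<le> out_prob I d x Us (f x)"
      unfolding out_prob_def using finite_qbasis[OF I, of d] by (intro sum_mono2) auto
    then show ?thesis
      using Us(3) x \<open>b \<in> qbasis I d\<close> by (simp add: b_def S_def ket_def)
  qed
  then show ?thesis
    unfolding computes_bounded_def using Us
    by (intro exI[of _ d] exI[of _ Us]) (simp add: d_def)
qed

lemma computes_bounded_Q: "finite I \<Longrightarrow> computes_bounded I f (Q I f)"
  unfolding Q_def using computes_bounded_card by (rule LeastI)

subsection \<open>Sensitivity and row moves\<close>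

text \<open>The adversary bound for the single input \<open>z\<close> against its neighbours: an
  index separates at most one pair seen from either side, and the weight
  \<open>1 / sqrt (card S)\<close> balances the sizes \<open>card S\<close> and 1 of the
  families.\<close>

lemma sensitivity_bound:
  assumes I: "finite I" and comp: "computes_bounded I f T"
    and z: "z \<in> inputs I" and S: "S \<subseteq> I" and flip: "\<And>i. i \<in> S \<Longrightarrow> f (z(i := \<not> z i)) \<noteq> f z"
  shows "sqrt (card S) \<le> 40 * real T"
proof (cases "card S = 0")
  case False
  define s where "s = sqrt (card S)"
  have s: "s > 0" "s * s = card S" using False by (auto simp: s_def)
  have fS: "finite S" using finite_subset[OF S I] .
  have "(\<Sum>j\<in>S. real (card {k\<in>{()}. True})) / 20 \<le> real T * ((1 / s) * (1::nat) * card S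
      + (1::nat) * card {()} / (1 / s))"
  proof (rule adversary_bound[OF I fS _ _ comp, where x = "\<lambda>i. z(i := \<not> z i)" and y = "\<lambda>_. z"])
    fix i
    have "{j \<in> S. True \<and> (z(j := \<not> z j)) i \<noteq> z i} \<subseteq> {i}" by auto
    from card_mono[OF _ this] show "card {j \<in> S. True \<and> (z(j := \<not> z j)) i \<noteq> z i} \<le> 1" by simp
    fix j
    have "{k \<in> {()}. True \<and> (z(j := \<not> z j)) i \<noteq> z i} \<subseteq> {()}" by auto
    from card_mono[OF _ this] show "card {k \<in> {()}. True \<and> (z(j := \<not> z j)) i \<noteq> z i} \<le> 1" by simp
  qed (use s z S flip in \<open>auto simp: inputs_def\<close>)
  then have "(s * s) / 20 \<le> real T * ((1 / s) * (s * s) + s)"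
    using s by simp
  also have "(1 / s) * (s * s) + s = 2 * s" using s(1) by simp
  finally show ?thesis using s(1) unfolding s_def[symmetric] by (simp add: field_simps)
qed simp

text \<open>An input consists of rows indexed by \<open>E\<close>. Moving a nonempty row to the place of an empty one
  preserves positivity, deleting it destroys positivity. The inputs are all arrangements of the
  rows, respectively all arrangements with one row deleted.\<close>

lemma row_move_bound:
  fixes \<rho>\<^sub>0 :: "'a \<Rightarrow> 'p set" and loc :: "'i \<Rightarrow> 'a"
  assumes I: "finite I" and comp: "computes_bounded I f T" and E: "finite E"
    and dep: "\<And>\<rho> \<rho>' i. \<rho> (loc i) = \<rho>' (loc i) \<Longrightarrow> g \<rho> i = g \<rho>' i"
    and inp: "\<And>\<rho>. g \<rho> \<in> inputs I"
    and pos: "\<And>\<sigma>. \<sigma> permutes E \<Longrightarrow> f (g (\<rho>\<^sub>0 \<circ> \<sigma>))"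
    and neg: "\<And>\<rho>. card {d\<in>E. \<rho> d \<noteq> {}} < card {d\<in>E. \<rho>\<^sub>0 d \<noteq> {}} \<Longrightarrow> \<not> f (g \<rho>)"
  shows "real (card {d\<in>E. \<rho>\<^sub>0 d \<noteq> {}}) * card {d\<in>E. \<rho>\<^sub>0 d = {}} \<le> 20 * real T * card E"
proof -
  define E1 where "E1 = {d\<in>E. \<rho>\<^sub>0 d \<noteq> {}}"
  define E0 where "E0 = {d\<in>E. \<rho>\<^sub>0 d = {}}"
  have fE: "finite E1" "finite E0" using E by (auto simp: E1_def E0_def)
  have cE: "card E = card E1 + card E0"
  proof -
    have "E = E1 \<union> E0" "E1 \<inter> E0 = {}" by (auto simp: E1_def E0_def)
    then show ?thesis using fE by (simp add: card_Un_disjoint)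
  qed
  define Sg where "Sg = {\<sigma>. \<sigma> permutes E}"
  have fS: "finite Sg" and S0: "card Sg > 0"
    using E by (auto simp: Sg_def finite_permutations card_permutations)
  \<comment> \<open>The row placed at \<open>d\<close> is the one with index
    \<open>\<sigma> d\<close>, and row \<open>c\<close> is deleted. Indexing by all permutations,
    even those giving equal arrangements, keeps the counts uniform.\<close>
  define x where "x = (\<lambda>(\<sigma>, c). g (\<lambda>d. if \<sigma> d = c then {} else \<rho>\<^sub>0 (\<sigma> d)))"
  define y where "y \<sigma> = g (\<rho>\<^sub>0 \<circ> \<sigma>)" for \<sigma>
  \<comment> \<open>The transposition moves row \<open>c\<close> to the place of the empty row
    \<open>c'\<close>.\<close>
  define r where "r = (\<lambda>(\<sigma> :: 'a \<Rightarrow> 'a, c) \<sigma>'. \<exists>c'\<in>E0. \<sigma>' = transpose c c' \<circ> \<sigma>)"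
  \<comment> \<open>At the old place of row \<open>c\<close> both inputs are empty, one by deletion
    and the other because it received the empty row \<open>c'\<close>. So they differ only at the
    new place.\<close>
  have diff: "c' = \<sigma> (loc i) \<and> c = (transpose c c' \<circ> \<sigma>) (loc i)"
    if "c \<in> E1" "c' \<in> E0" "x (\<sigma>, c) i \<noteq> y (transpose c c' \<circ> \<sigma>) i" for \<sigma> c c' i
  proof -
    have "(if \<sigma> (loc i) = c then {} else \<rho>\<^sub>0 (\<sigma> (loc i))) \<noteq> (\<rho>\<^sub>0 \<circ> (transpose c c' \<circ> \<sigma>)) (loc i)"
    proof
      assume "(if \<sigma> (loc i) = c then {} else \<rho>\<^sub>0 (\<sigma> (loc i))) = (\<rho>\<^sub>0 \<circ> (transpose c c' \<circ> \<sigma>)) (loc i)"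
      then have "g (\<lambda>d. if \<sigma> d = c then {} else \<rho>\<^sub>0 (\<sigma> d)) i = g (\<rho>\<^sub>0 \<circ> (transpose c c' \<circ> \<sigma>)) i"
        by (rule dep)
      then show False using that(3) unfolding x_def y_def prod.case by simp
    qed
    then have "\<sigma> (loc i) = c'"
      using that(1,2) by (auto simp: E0_def transpose_def split: if_splits)
    then show ?thesis by simp
  qed
  have rel: "{\<sigma>'\<in>Sg. r (\<sigma>, c) \<sigma>'} = (\<lambda>c'. transpose c c' \<circ> \<sigma>) ` E0"
    if "\<sigma> \<in> Sg" "c \<in> E1" for \<sigma> c
  proof -
    have "transpose c c' \<circ> \<sigma> \<in> Sg" if "c' \<in> E0" for c'
      using that \<open>\<sigma> \<in> Sg\<close> \<open>c \<in> E1\<close>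
      by (auto simp: Sg_def E0_def E1_def intro!: permutes_compose permutes_swap_id)
    then show ?thesis by (auto simp: r_def)
  qed
  have inj: "inj_on (\<lambda>c'. transpose c c' \<circ> \<sigma>) E0" if "\<sigma> \<in> Sg" "c \<in> E1" for \<sigma> c
  proof (rule inj_onI)
    fix u v assume "transpose c u \<circ> \<sigma> = transpose c v \<circ> \<sigma>"
    then have "(transpose c u \<circ> \<sigma>) (inv \<sigma> c) = (transpose c v \<circ> \<sigma>) (inv \<sigma> c)" by simp
    then show "u = v"
      using that by (simp add: Sg_def permutes_inverses)
  qed
  \<comment> \<open>The weight is 1. By \<open>diff\<close>, an index \<open>i\<close> and
    \<open>(\<sigma>, c)\<close> determine \<open>c'\<close>, leaving one partner; \<open>i\<close>
    and \<open>k\<close> determine \<open>c\<close> and leave only the choice of \<open>c'\<close>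
    in \<open>E0\<close>.\<close>
  have "(\<Sum>j\<in>Sg \<times> E1. real (card {k\<in>Sg. r j k})) / 20
      \<le> real T * (1 * real (1::nat) * real (card (Sg \<times> E1)) + real (card E0 * card Sg) / 1)"
  proof (rule adversary_bound[OF I _ fS _ comp, where x = x and y = y])
    show "finite (Sg \<times> E1)" using fS fE by simp
    show "x j \<in> inputs I" for j by (cases j) (simp add: x_def inp)
    show "y k \<in> inputs I" for k by (simp add: y_def inp)
    show "f (x j) \<noteq> f (y k)" if j: "j \<in> Sg \<times> E1" and k: "k \<in> Sg" for j k
    proof -
      obtain \<sigma> c where sc: "j = (\<sigma>, c)" "\<sigma> permutes E" "c \<in> E1" using j by (auto simp: Sg_def)
      have "{d\<in>E. (if \<sigma> d = c then {} else \<rho>\<^sub>0 (\<sigma> d)) \<noteq> {}} = {d\<in>E. \<sigma> d \<in> E1 - {c}}"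
        using sc permutes_in_image[OF sc(2)] by (auto simp: E1_def)
      also have "card \<dots> \<le> card (E1 - {c})"
        using fE permutes_inj_on[OF sc(2)] by (intro card_inj_on_le[of \<sigma>]) auto
      also have "\<dots> < card E1" using sc(3) fE by (intro psubset_card_mono) auto
      finally have "\<not> f (x j)" using neg by (simp add: x_def sc(1) E1_def)
      moreover have "f (y k)" using k pos by (simp add: y_def Sg_def)
      ultimately show ?thesis by blast
    qed
    show "card {k \<in> Sg. r j k \<and> x j i \<noteq> y k i} \<le> 1" if j: "j \<in> Sg \<times> E1" for j i
    proof -
      obtain \<sigma> c where sc: "j = (\<sigma>, c)" "c \<in> E1" using j by auto
      have "{k \<in> Sg. r j k \<and> x j i \<noteq> y k i} \<subseteq> {transpose c (\<sigma> (loc i)) \<circ> \<sigma>}"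
        using diff[OF sc(2)] by (auto simp: r_def sc(1))
      from card_mono[OF _ this] show ?thesis by simp
    qed
    show "card {j \<in> Sg \<times> E1. r j k \<and> x j i \<noteq> y k i} \<le> card E0" if "k \<in> Sg" for k i
    proof -
      have "{j \<in> Sg \<times> E1. r j k \<and> x j i \<noteq> y k i}
          \<subseteq> (\<lambda>c'. (transpose (k (loc i)) c' \<circ> k, k (loc i))) ` E0"
      proof
        fix j assume j: "j \<in> {j \<in> Sg \<times> E1. r j k \<and> x j i \<noteq> y k i}"
        obtain \<sigma> c where sc: "j = (\<sigma>, c)" "c \<in> E1" using j by auto
        from j sc obtain c' where c': "c' \<in> E0" "k = transpose c c' \<circ> \<sigma>" by (auto simp: r_def)
        then have c: "c = k (loc i)" using diff[OF sc(2) c'(1)] j sc by auto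
        have "transpose c c' \<circ> k = \<sigma>" by (simp add: c'(2) fun_eq_iff)
        then show "j \<in> (\<lambda>c'. (transpose (k (loc i)) c' \<circ> k, k (loc i))) ` E0"
          using c'(1) sc(1) unfolding c[symmetric] by blast
      qed
      from card_mono[OF _ this] card_image_le[OF fE(2)] fE show ?thesis
        by (meson finite_imageI le_trans)
    qed
  qed simp
  moreover have "(\<Sum>j\<in>Sg \<times> E1. real (card {k\<in>Sg. r j k})) = (\<Sum>j\<in>Sg \<times> E1. real (card E0))"
    by (intro sum.cong refl) (auto simp: rel card_image[OF inj])
  ultimately have "real (card Sg) * (real (card E1) * card E0)
      \<le> real (card Sg) * (20 * real T * (card E1 + card E0))"
    by (simp add: card_cartesian_product algebra_simps)
  then show ?thesis
    using S0 cE unfolding E1_def[symmetric] E0_def[symmetric] by simp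
qed

subsection \<open>Subhypergraph containment\<close>

text \<open>Associated inputs contain all triples meeting \<open>D\<close>; \<open>C\<close> is empty in the first case of the
  proof and \<open>{c}\<close> in the second, where \<open>W\<close> is independent in the link of \<open>c\<close>.\<close>

definition configuration :: "nat \<Rightarrow> nat set set \<Rightarrow> nat set \<Rightarrow> nat set \<Rightarrow> nat set \<Rightarrow> bool" where
  "configuration n H D C W \<longleftrightarrow> D \<subseteq> {..<n} \<and> C \<subseteq> {..<n} \<and> W \<subseteq> {..<n} \<and>
     D \<inter> C = {} \<and> D \<inter> W = {} \<and> C \<inter> W = {} \<and>
     (\<forall>e\<in>H. e \<inter> D = {} \<longrightarrow> C \<subseteq> e \<and> \<not> e \<subseteq> W \<union> C)"

text \<open>In a configuration these are the outside vertices whose addition to \<open>W\<close>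
  would violate the last condition of \<open>configuration\<close>.\<close>

definition blocked :: "nat \<Rightarrow> nat set set \<Rightarrow> nat set \<Rightarrow> nat set \<Rightarrow> nat set \<Rightarrow> nat set" where
  "blocked n H D C W = {d \<in> {..<n} - D - C - W. \<exists>e\<in>H. e \<inter> D = {} \<and> d \<in> e \<and> e \<subseteq> insert d (W \<union> C)}"

lemma finite_triples: "finite (triples n)"
  by (rule finite_subset[of _ "Pow {..<n}"]) (auto simp: triples_def)

lemma configuration_finite:
  "configuration n H D C W \<Longrightarrow> finite D \<and> finite C \<and> finite W"
  unfolding configuration_def by (meson finite_lessThan finite_subset)

lemma card_configuration_rest:
  assumes "configuration n H D C W"
  shows "card D + card C + card W + card ({..<n} - D - C - W) = n"
proof -
  have fin: "finite D" "finite C" "finite W" using configuration_finite[OF assms] by auto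
  have "card ({..<n} - (D \<union> C \<union> W)) = n - card (D \<union> C \<union> W)"
    using assms fin by (subst card_Diff_subset) (auto simp: configuration_def)
  moreover have "card (D \<union> C \<union> W) = card D + card C + card W"
    using assms fin by (simp add: card_Un_disjoint configuration_def Int_Un_distrib2)
  moreover have "card (D \<union> C \<union> W) \<le> n"
    using assms card_mono[of "{..<n}" "D \<union> C \<union> W"] by (auto simp: configuration_def)
  moreover have "{..<n} - (D \<union> C \<union> W) = {..<n} - D - C - W" by auto
  ultimately show ?thesis by simp
qed

text \<open>Apply \<open>row_move_bound\<close> with the outside vertices as places. Permuting rows
  only relabels vertices of \<open>H\<close>. A copy of \<open>H\<close> in an input with fewer
  nonempty rows would pull \<open>D\<close>, \<open>C\<close> and \<open>W\<close> back to a
  configuration with fewer blocked vertices, against \<open>least\<close>.\<close>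

lemma configuration_row_bound:
  assumes H: "H \<subseteq> triples n" and cf: "configuration n H D C W"
    and comp: "computes_bounded (triples n) (f_H n H) T"
    and least: "\<And>D' C' W'. configuration n H D' C' W' \<Longrightarrow> card D' = card D \<Longrightarrow> card C' = card C \<Longrightarrow>
      card W' = card W \<Longrightarrow> card (blocked n H D C W) \<le> card (blocked n H D' C' W')"
  shows "real (card (blocked n H D C W)) * card ({..<n} - D - C - W - blocked n H D C W)
    \<le> 20 * real T * card ({..<n} - D - C - W)"
proof -
  define E where "E = {..<n} - D - C - W"
  have E: "finite E" by (simp add: E_def)
  \<comment> \<open>Among triples that avoid \<open>D\<close> and contain \<open>C\<close>, those
    with two or more vertices in \<open>E\<close> are present, and those with one vertex there are
    read from its row.\<close>
  define g where "g \<rho> e \<longleftrightarrow> e \<in> triples n \<and> (e \<inter> D \<noteq> {} \<or>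
    (C \<subseteq> e \<and> (2 \<le> card (e \<inter> E) \<or> (\<exists>d. e \<inter> E = {d} \<and> e - {d} \<in> \<rho> d))))" for \<rho> e
  \<comment> \<open>If \<open>e \<inter> E\<close> is no singleton, this value is arbitrary, but
    then \<open>g\<close> reads no row at \<open>e\<close>.\<close>
  define loc where "loc e = (SOME d. e \<inter> E = {d})" for e
  define \<rho>0 where "\<rho>0 d = {e - {d} | e. e \<in> H \<and> e \<inter> D = {} \<and> e \<inter> E = {d}}" for d
  have sub: "e \<subseteq> {..<n}" "card e = 3" if "e \<in> H" for e
    using H that by (auto simp: triples_def)
  have bl: "blocked n H D C W = {d\<in>E. \<rho>0 d \<noteq> {}}"
  proof -
    have "(e \<inter> D = {} \<and> d \<in> e \<and> e \<subseteq> insert d (W \<union> C)) \<longleftrightarrow> (e \<inter> D = {} \<and> e \<inter> E = {d})"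
      if "e \<in> H" "d \<in> E" for e d
      using that sub(1)[OF that(1)] cf unfolding configuration_def E_def by auto
    then have "(\<exists>e\<in>H. e \<inter> D = {} \<and> d \<in> e \<and> e \<subseteq> insert d (W \<union> C)) \<longleftrightarrow> \<rho>0 d \<noteq> {}"
      if "d \<in> E" for d
      using that unfolding \<rho>0_def ex_in_conv[symmetric] mem_Collect_eq by metis
    then show ?thesis unfolding blocked_def E_def[symmetric] by (intro Collect_cong conj_cong refl)
  qed
  have "real (card {d\<in>E. \<rho>0 d \<noteq> {}}) * card {d\<in>E. \<rho>0 d = {}} \<le> 20 * real T * card E"
  proof (rule row_move_bound[OF finite_triples comp E, where g = g and loc = loc])
    show "g \<rho> e = g \<rho>' e" if "\<rho> (loc e) = \<rho>' (loc e)" for \<rho> \<rho>' e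
    proof -
      have "loc e = d" if "e \<inter> E = {d}" for d unfolding loc_def that by auto
      then show ?thesis using that unfolding g_def by auto
    qed
    show "g \<rho> \<in> inputs (triples n)" for \<rho> by (auto simp: inputs_def g_def)
    show "f_H n H (g (\<rho>0 \<circ> \<sigma>))" if \<sigma>: "\<sigma> permutes E" for \<sigma>
      unfolding f_H_def
    proof (intro exI[of _ "inv \<sigma>"] conjI ballI)
      \<comment> \<open>Row \<open>d\<close> now sits at the place that \<open>\<sigma>\<close>
        sends to \<open>d\<close>, so the embedding moves \<open>d\<close> there and fixes
        everything outside \<open>E\<close>.\<close>
      define \<pi> where "\<pi> = inv \<sigma>"
      have \<pi>: "\<pi> permutes E" unfolding \<pi>_def using \<sigma> by (rule permutes_inv)
      have \<pi>V: "\<pi> permutes {..<n}" by (rule permutes_subset[OF \<pi>]) (auto simp: E_def)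
      then show "bij_betw (inv \<sigma>) {..<n} {..<n}" unfolding \<pi>_def by (rule permutes_imp_bij)
      fix e assume e: "e \<in> H"
      have fix_out: "\<pi> v = v" if "v \<notin> E" for v using \<pi> that by (rule permutes_not_in)
      have tri: "\<pi> ` e \<in> triples n"
        using sub[OF e] permutes_image[OF \<pi>V] permutes_inj[OF \<pi>V]
        by (auto simp: triples_def card_image inj_on_subset)
      have cap: "\<pi> ` e \<inter> E = \<pi> ` (e \<inter> E)"
        using permutes_in_image[OF \<pi>] by auto
      have "g (\<rho>0 \<circ> \<sigma>) (\<pi> ` e)"
      proof (cases "e \<inter> D = {}")
        case False
        then obtain v where v: "v \<in> e" "v \<in> D" by auto
        then have "\<pi> v = v" using cf by (intro fix_out) (auto simp: E_def)
        then have "v \<in> \<pi> ` e \<inter> D" using v by (metis IntI image_eqI)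
        then show ?thesis using tri unfolding g_def by blast
      next
        case True
        then have Ce: "C \<subseteq> e" and ne: "\<not> e \<subseteq> W \<union> C"
          using cf e by (auto simp: configuration_def)
        have "C \<subseteq> \<pi> ` e"
        proof
          fix v assume "v \<in> C"
          then have "\<pi> v = v" "v \<in> e" using Ce by (auto intro: fix_out simp: E_def)
          then show "v \<in> \<pi> ` e" by (metis image_eqI)
        qed
        moreover have cd: "card (\<pi> ` e \<inter> E) = card (e \<inter> E)"
          unfolding cap using permutes_inj[OF \<pi>] by (simp add: card_image inj_on_subset)
        moreover have "e \<inter> E \<noteq> {}" using ne sub(1)[OF e] True by (auto simp: E_def)
        then have "card (e \<inter> E) > 0" using E by (simp add: card_gt_0_iff)
        then have "2 \<le> card (e \<inter> E) \<or> card (e \<inter> E) = 1" by arith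
        moreover have "\<exists>d. \<pi> ` e \<inter> E = {d} \<and> \<pi> ` e - {d} \<in> (\<rho>0 \<circ> \<sigma>) d" if "card (e \<inter> E) = 1"
        proof -
          from that obtain d where d: "e \<inter> E = {d}" by (auto simp: card_1_singleton_iff)
          have "\<pi> ` e - {\<pi> d} = \<pi> ` (e - {d})"
            using permutes_inj[OF \<pi>] by (auto simp: inj_eq)
          also have "\<dots> = (\<lambda>v. v) ` (e - {d})"
            using d by (intro image_cong refl fix_out) auto
          finally have "\<pi> ` e - {\<pi> d} = e - {d}" by simp
          moreover have "\<sigma> (\<pi> d) = d" using \<sigma> unfolding \<pi>_def by (simp add: permutes_inverses)
          moreover have "e - {d} \<in> \<rho>0 d" unfolding \<rho>0_def using d e True by blast
          moreover have "\<pi> ` e \<inter> E = {\<pi> d}" by (simp add: cap d)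
          ultimately show ?thesis by (intro exI[of _ "\<pi> d"]) simp
        qed
        ultimately show ?thesis using tri unfolding g_def by metis
      qed
      then show "g (\<rho>0 \<circ> \<sigma>) (inv \<sigma> ` e)" unfolding \<pi>_def .
    qed
    show "\<not> f_H n H (g \<rho>)" if few: "card {d\<in>E. \<rho> d \<noteq> {}} < card {d\<in>E. \<rho>0 d \<noteq> {}}" for \<rho>
    proof
      assume "f_H n H (g \<rho>)"
      then obtain \<pi> where \<pi>: "bij_betw \<pi> {..<n} {..<n}" and img: "\<And>e. e \<in> H \<Longrightarrow> g \<rho> (\<pi> ` e)"
        unfolding f_H_def by blast
      \<comment> \<open>The preimages form a configuration: an edge avoiding \<open>pre D\<close>
        lands on a present triple avoiding \<open>D\<close>, which contains \<open>C\<close> and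
        meets \<open>E\<close>.\<close>
      define pre where "pre A = {v\<in>{..<n}. \<pi> v \<in> A}" for A
      have \<pi>im: "\<pi> ` {..<n} = {..<n}" and inj: "inj_on \<pi> {..<n}" using \<pi> by (auto simp: bij_betw_def)
      have cpre: "card (pre A) = card A" if "A \<subseteq> {..<n}" for A
      proof -
        have "\<pi> ` pre A = A"
        proof
          show "A \<subseteq> \<pi> ` pre A"
          proof
            fix u assume u: "u \<in> A"
            then have "u \<in> \<pi> ` {..<n}" using \<pi>im that by blast
            then show "u \<in> \<pi> ` pre A" using u unfolding pre_def by blast
          qed
        qed (auto simp: pre_def)
        moreover have "inj_on \<pi> (pre A)" by (rule inj_on_subset[OF inj]) (auto simp: pre_def)
        ultimately show ?thesis using card_image by metis
      qed
      have ED: "E \<inter> D = {}" "E \<inter> C = {}" "E \<inter> W = {}" by (auto simp: E_def)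
      have cf': "configuration n H (pre D) (pre C) (pre W)"
        unfolding configuration_def
      proof (intro conjI ballI impI)
        show "pre D \<subseteq> {..<n}" "pre C \<subseteq> {..<n}" "pre W \<subseteq> {..<n}" by (auto simp: pre_def)
        show "pre D \<inter> pre C = {}" "pre D \<inter> pre W = {}" "pre C \<inter> pre W = {}"
          using cf by (auto simp: pre_def configuration_def)
        fix e assume e: "e \<in> H" "e \<inter> pre D = {}"
        then have nD: "\<pi> ` e \<inter> D = {}" using sub(1)[OF e(1)] by (auto simp: pre_def)
        have *: "C \<subseteq> \<pi> ` e" "2 \<le> card (\<pi> ` e \<inter> E) \<or> (\<exists>d. \<pi> ` e \<inter> E = {d})"
          using img[OF e(1)] unfolding g_def by (simp_all add: nD) metis
        show "pre C \<subseteq> e"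
        proof
          fix v assume v: "v \<in> pre C"
          then obtain u where u: "u \<in> e" "\<pi> v = \<pi> u" using *(1) by (auto simp: pre_def)
          then have "v = u" using inj_onD[OF inj u(2)] v sub(1)[OF e(1)] by (auto simp: pre_def)
          then show "v \<in> e" using u by simp
        qed
        have "\<pi> ` e \<inter> E \<noteq> {}" using *(2) by auto
        then obtain v where "v \<in> e" "\<pi> v \<in> E" by blast
        then show "\<not> e \<subseteq> pre W \<union> pre C" using ED unfolding pre_def by blast
      qed
      have cards: "card (pre D) = card D" "card (pre C) = card C" "card (pre W) = card W"
        using cf by (auto intro!: cpre simp: configuration_def)
      \<comment> \<open>An edge witnessing that a vertex is blocked lands on a triple with one
        vertex in \<open>E\<close>, whose presence requires a nonempty row there.\<close>
      have "\<pi> ` blocked n H (pre D) (pre C) (pre W) \<subseteq> {d\<in>E. \<rho> d \<noteq> {}}"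
      proof
        fix u assume "u \<in> \<pi> ` blocked n H (pre D) (pre C) (pre W)"
        then obtain d e where d: "u = \<pi> d" "d < n" "d \<notin> pre D" "d \<notin> pre C" "d \<notin> pre W"
          and e: "e \<in> H" "e \<inter> pre D = {}" "d \<in> e" "e \<subseteq> insert d (pre W \<union> pre C)"
          by (auto simp: blocked_def)
        have "\<pi> d \<in> {..<n}" using d(2) \<pi>im by blast
        then have uE: "u \<in> E" using d by (simp add: E_def pre_def)
        have nD: "\<pi> ` e \<inter> D = {}" using e(2) sub(1)[OF e(1)] by (auto simp: pre_def)
        have one: "\<pi> ` e \<inter> E = {u}"
          using e(3,4) d(1) uE ED by (auto simp: pre_def)
        then have "\<pi> ` e - {u} \<in> \<rho> u"
          using img[OF e(1)] nD unfolding g_def by auto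
        then show "u \<in> {d\<in>E. \<rho> d \<noteq> {}}" using uE by auto
      qed
      moreover have "inj_on \<pi> (blocked n H (pre D) (pre C) (pre W))"
        by (rule inj_on_subset[OF inj]) (auto simp: blocked_def)
      ultimately have "card (blocked n H (pre D) (pre C) (pre W)) \<le> card {d\<in>E. \<rho> d \<noteq> {}}"
        using E by (intro card_inj_on_le[of \<pi>]) auto
      then show False
        using least[OF cf' cards] few unfolding bl by linarith
    qed
  qed
  moreover have "{d\<in>E. \<rho>0 d = {}} = E - blocked n H D C W" unfolding bl by auto
  ultimately show ?thesis unfolding bl[symmetric] E_def[symmetric] by simp
qed

section \<open>Degree counting and the case without large independent sets\<close>

lemma triplesD:
  assumes "e \<in> triples n"
  shows "finite e" "card e = 3" "e \<subseteq> {..<n}"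
  using assms finite_subset[of e "{..<n}"] by (auto simp: triples_def)

lemma sum_degrees_le:
  assumes H: "H \<subseteq> triples n" and Z: "finite Z"
  shows "(\<Sum>z\<in>Z. card {e\<in>H. z \<in> e}) \<le> 3 * card H"
proof -
  have fH: "finite H" using finite_subset[OF H finite_triples] .
  have "(\<Sum>z\<in>Z. card {e\<in>H. z \<in> e}) = (\<Sum>e\<in>H. card {z\<in>Z. z \<in> e})"
    using sum.swap_restrict[OF Z fH, of "\<lambda>_ _. 1::nat" "\<lambda>z e. z \<in> e"] by simp
  also have "\<dots> \<le> (\<Sum>e\<in>H. 3)"
  proof (rule sum_mono)
    fix e assume "e \<in> H"
    then have "finite e" "card e = 3" using H triplesD by blast+
    then show "card {z\<in>Z. z \<in> e} \<le> 3" using card_mono[of e "{z\<in>Z. z \<in> e}"] by auto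
  qed
  finally show ?thesis by simp
qed

text \<open>Adding an unblocked vertex of small degree to \<open>W\<close> blocks only few new vertices, so the least
  number of blocked vertices grows slowly with the size of \<open>W\<close>.\<close>

lemma configuration_grow:
  assumes H: "H \<subseteq> triples n" and cf: "configuration n H D C W"
    and N: "N = real (n - card D - card C)" "N > 0"
    and small: "2 * real (card W) \<le> N" and few: "8 * real (card (blocked n H D C W)) < N"
    and edges: "192 * real (card H) \<le> N\<^sup>2"
  shows "\<exists>z. configuration n H D C (insert z W) \<and> card (insert z W) = Suc (card W) \<and>
    4 * real (card (blocked n H D C (insert z W))) < N"
proof -
  define B where "B = blocked n H D C W"
  define Z where "Z = {..<n} - D - C - W - B"
  have fB: "finite B" by (simp add: B_def blocked_def)
  have fH: "finite H" using finite_subset[OF H finite_triples] .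
  have "card Z = card ({..<n} - D - C - W) - card B"
    unfolding Z_def using fB by (intro card_Diff_subset) (auto simp: B_def blocked_def)
  \<comment> \<open>\<open>W\<close> takes at most N/2 and the blocked vertices less than N/8 of the
    \<open>N\<close> vertices.\<close>
  then have Zbig: "8 * real (card Z) \<ge> 3 * N"
    using card_configuration_rest[OF cf] N(1) small few unfolding B_def by linarith
  \<comment> \<open>Averaging: otherwise the degree sum over \<open>Z\<close> exceeds (3N/8) *
    (N/24) = N^2/64, while it is at most \<open>3 * card H\<close>; hence the constant 192.\<close>
  have "\<exists>z\<in>Z. 24 * real (card {e\<in>H. z \<in> e}) \<le> N"
  proof (rule ccontr)
    assume contra: "\<not> ?thesis"
    have big: "N / 24 < real (card {e\<in>H. z \<in> e})" if "z \<in> Z" for z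
    proof -
      have "\<not> 24 * real (card {e\<in>H. z \<in> e}) \<le> N" using contra that by blast
      then show ?thesis by linarith
    qed
    have fZ: "finite Z" by (simp add: Z_def)
    have "Z \<noteq> {}" using Zbig N(2) by auto
    then have "(\<Sum>z\<in>Z. N / 24) < (\<Sum>z\<in>Z. real (card {e\<in>H. z \<in> e}))"
      using fZ big by (intro sum_strict_mono) auto
    also have "\<dots> \<le> 3 * real (card H)"
      using of_nat_mono[OF sum_degrees_le[OF H fZ], where 'a = real] by simp
    finally have "card Z * N < 72 * card H" by simp
    moreover have "3 * N * N \<le> 8 * card Z * N" using Zbig N(2) by (intro mult_right_mono) auto
    ultimately show False using edges by (simp add: power2_eq_square)
  qed
  then obtain z where z: "z \<in> Z" and deg: "24 * real (card {e\<in>H. z \<in> e}) \<le> N" by blast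
  have zn: "z < n" "z \<notin> D" "z \<notin> C" "z \<notin> W" "z \<notin> B" using z by (auto simp: Z_def)
  have cf': "configuration n H D C (insert z W)"
  proof -
    have "\<not> e \<subseteq> insert z W \<union> C" if e: "e \<in> H" "e \<inter> D = {}" for e
    proof
      assume sub: "e \<subseteq> insert z W \<union> C"
      have "\<not> e \<subseteq> W \<union> C" using cf e by (auto simp: configuration_def)
      then have "z \<in> e" using sub by auto
      then have "z \<in> B" unfolding B_def blocked_def using zn e sub by auto
      then show False using zn by simp
    qed
    then show ?thesis using cf zn unfolding configuration_def by auto
  qed
  \<comment> \<open>New blocked vertices lie on edges at \<open>z\<close>, of which there are at
    most N/24 with three vertices each. This adds at most N/8 to a number below N/8.\<close>
  have sub: "blocked n H D C (insert z W) \<subseteq> B \<union> \<Union>{e\<in>H. z \<in> e}"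
    unfolding B_def blocked_def by auto
  have fin3: "finite e \<and> card e = 3" if "e \<in> H" for e
    using H that triplesD by blast
  have "card (\<Union>{e\<in>H. z \<in> e}) \<le> (\<Sum>e\<in>{e\<in>H. z \<in> e}. card e)"
    by (rule card_Union_le_sum_card)
  also have "\<dots> = 3 * card {e\<in>H. z \<in> e}" using fin3 by simp
  finally have "card (B \<union> \<Union>{e\<in>H. z \<in> e}) \<le> card B + 3 * card {e\<in>H. z \<in> e}"
    using card_Un_le[of B "\<Union>{e\<in>H. z \<in> e}"] by linarith
  moreover have "finite (B \<union> \<Union>{e\<in>H. z \<in> e})" using fB fH fin3 by auto
  ultimately have "card (blocked n H D C (insert z W)) \<le> card B + 3 * card {e\<in>H. z \<in> e}"
    using card_mono[OF _ sub] by linarith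
  then have "4 * real (card (blocked n H D C (insert z W))) < N"
    using deg few unfolding B_def by linarith
  moreover have "card (insert z W) = Suc (card W)"
    using zn configuration_finite[OF cf] by simp
  ultimately show ?thesis using cf' by blast
qed

text \<open>Take the least size at which every configuration blocks at least N/8 vertices. One size
  lower some configuration blocks fewer, and growing it gives one of the critical size blocking
  fewer than N/4. The minimiser ranges over \<open>D\<close> and \<open>C\<close> too, since an
  embedding may move them.\<close>

lemma small_independent_bound:
  assumes H: "H \<subseteq> triples n" and comp: "computes_bounded (triples n) (f_H n H) T"
    and cf0: "configuration n H D0 C0 {}" and C0: "card C0 \<le> 1"
    and N: "N = real (n - card D0 - card C0)" "N > 0"
    and small: "\<And>D C W. configuration n H D C W \<Longrightarrow> card D = card D0 \<Longrightarrow> card C = card C0 \<Longrightarrow>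
      2 * real (card W) \<le> N"
    and edges: "192 * real (card H) \<le> N\<^sup>2"
  shows "N \<le> 640 * real T"
proof -
  define cfw where "cfw w D C W \<longleftrightarrow>
    configuration n H D C W \<and> card D = card D0 \<and> card C = card C0 \<and> card W = w" for w D C W
  define many where "many w \<longleftrightarrow> (\<forall>D C W. cfw w D C W \<longrightarrow> N \<le> 8 * real (card (blocked n H D C W)))" for w
  define w where "w = (LEAST w. many w)"
  \<comment> \<open>Vacuously true: by \<open>small\<close> no configuration has so large a
    \<open>W\<close>.\<close>
  have "many (Suc n)"
    unfolding many_def cfw_def using small N(1) by fastforce
  then have w: "many w" unfolding w_def by (rule LeastI)
  \<comment> \<open>With \<open>W\<close> empty a blocking edge would have at most two
    vertices.\<close>
  have "blocked n H D0 C0 {} = {}"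
  proof -
    have False if "e \<in> H" "e \<subseteq> insert d C0" for e d
    proof -
      have "finite C0" using configuration_finite[OF cf0] by simp
      then have "card e \<le> card (insert d C0)" using that(2) by (intro card_mono) auto
      also have "\<dots> \<le> Suc (card C0)" by (rule card_insert_le_m1[of "Suc (card C0)", simplified]) simp
      finally have "card e \<le> Suc (card C0)" .
      then show False using that(1) H C0 by (auto simp: triples_def)
    qed
    then show ?thesis unfolding blocked_def by auto
  qed
  then have "\<not> many 0" unfolding many_def cfw_def using cf0 N(2)
    by (intro notI) (drule spec[of _ D0], drule spec[of _ C0], drule spec[of _ "{}"], simp)
  with w have "w \<noteq> 0" by metis
  then obtain w' where w': "w = Suc w'" by (cases w) auto
  then have "\<not> many w'" unfolding w_def by (metis lessI not_less_Least)
  then obtain D1 C1 W1 where c1: "cfw w' D1 C1 W1" "8 * real (card (blocked n H D1 C1 W1)) < N"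
    unfolding many_def by force
  then have "\<exists>z. configuration n H D1 C1 (insert z W1) \<and> card (insert z W1) = Suc (card W1) \<and>
    4 * real (card (blocked n H D1 C1 (insert z W1))) < N"
    using small N edges by (intro configuration_grow[OF H]) (auto simp: cfw_def)
  then obtain z where z: "cfw w D1 C1 (insert z W1)"
      "4 * real (card (blocked n H D1 C1 (insert z W1))) < N"
    using c1(1) by (auto simp: cfw_def w')
  define size where "size = (\<lambda>(D, C, W). card (blocked n H D C W))"
  obtain q where q: "(\<lambda>(D, C, W). cfw w D C W) q"
    and qmin: "\<And>q'. (\<lambda>(D, C, W). cfw w D C W) q' \<Longrightarrow> size q \<le> size q'"
    using ex_has_least_nat[of "\<lambda>(D, C, W). cfw w D C W" "(D1, C1, insert z W1)" size] z(1) by auto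
  obtain D C W where DCW: "q = (D, C, W)" by (cases q)
  define B where "B = blocked n H D C W"
  define E where "E = {..<n} - D - C - W"
  have c: "configuration n H D C W" "card D = card D0" "card C = card C0" "card W = w"
    using q by (auto simp: DCW cfw_def)
  have "card B \<le> card (blocked n H D1 C1 (insert z W1))"
    using qmin[of "(D1, C1, insert z W1)"] z(1) by (simp add: DCW size_def B_def)
  then have Bup: "4 * real (card B) < N" using z(2) by linarith
  have Blow: "N \<le> 8 * real (card B)" using w q unfolding many_def B_def DCW by auto
  have bound: "real (card B) * card (E - B) \<le> 20 * real T * card E"
    unfolding B_def E_def
  proof (rule configuration_row_bound[OF H c(1) comp])
    show "card (blocked n H D C W) \<le> card (blocked n H D' C' W')"
      if "configuration n H D' C' W'" "card D' = card D" "card C' = card C" "card W' = card W"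
      for D' C' W'
      using qmin[of "(D', C', W')"] that c by (simp add: DCW size_def cfw_def)
  qed
  have "card (E - B) = card E - card B"
    by (rule card_Diff_subset) (auto simp: B_def E_def blocked_def)
  moreover have cE: "real (card E) = N - card W"
    using card_configuration_rest[OF c(1)] N c unfolding E_def by linarith
  \<comment> \<open>At least N/2 vertices lie outside \<open>W\<close>, and fewer than N/4 of them
    are blocked.\<close>
  ultimately have "N \<le> 4 * real (card (E - B))"
    using small[OF c(1-3)] Bup by linarith
  then have "(N / 8) * (N / 4) \<le> real (card B) * card (E - B)"
    using Blow N(2) by (intro mult_mono) auto
  also have "\<dots> \<le> 20 * real T * N"
    using bound cE mult_left_mono[of "real (card E)" N "20 * real T"] by simp
  finally show ?thesis using N(2) by (simp add: field_simps)
qed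

section \<open>The case of a large independent set in a link\<close>

lemma bij_betw_extend:
  assumes "finite V" "A \<subseteq> V" "finite V'" "A' \<subseteq> V'" "card A = card A'" "card V = card V'"
  shows "\<exists>\<pi>. bij_betw \<pi> V V' \<and> \<pi> ` A = A'"
proof -
  have fin: "finite A" "finite A'" using assms finite_subset by blast+
  have "card (V - A) = card (V' - A')" using assms fin by (simp add: card_Diff_subset)
  then obtain h k where h: "bij_betw h A A'" and k: "bij_betw k (V - A) (V' - A')"
    using assms fin by (metis finite_Diff finite_same_card_bij)
  define \<pi> where "\<pi> v = (if v \<in> A then h v else k v)" for v
  have "bij_betw \<pi> A A'" using h by (rule bij_betw_cong[THEN iffD1, rotated]) (simp add: \<pi>_def)
  moreover have "bij_betw \<pi> (V - A) (V' - A')"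
    using k by (rule bij_betw_cong[THEN iffD1, rotated]) (simp add: \<pi>_def)
  ultimately have "bij_betw \<pi> (A \<union> (V - A)) (A' \<union> (V' - A'))"
    by (rule bij_betw_combine) auto
  moreover have "A \<union> (V - A) = V" "A' \<union> (V' - A') = V'" using assms by auto
  moreover have "\<pi> ` A = A'" using \<open>bij_betw \<pi> A A'\<close> by (rule bij_betw_imp_surj_on)
  ultimately show ?thesis by auto
qed

text \<open>Let \<open>M\<close> be the set of triples missing from a maximal negative input. If the triples of \<open>M\<close>
  at some vertex \<open>a \<notin> D\<close> covered at most \<open>card W\<close> vertices besides \<open>a\<close>, then \<open>H\<close> would embed
  with \<open>c\<close> at \<open>a\<close> and \<open>W\<close> over these vertices. Hence \<open>M\<close> has quadratic size.\<close>

lemma large_independent_bound: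
  assumes H: "H \<subseteq> triples n" and comp: "computes_bounded (triples n) (f_H n H) T"
    and cf: "configuration n H D {c} W"
    and N: "N = real (n - card D - 1)" and large: "N \<le> 2 * real (card W)"
    and neg: "\<not> f_H n H (\<lambda>e. e \<in> triples n \<and> e \<inter> D \<noteq> {})"
  shows "N \<le> 160 * real T"
proof -
  define V where "V = {..<n}"
  define neg_set where "neg_set Z \<longleftrightarrow>
    Z \<subseteq> triples n \<and> {e\<in>triples n. e \<inter> D \<noteq> {}} \<subseteq> Z \<and> \<not> f_H n H (\<lambda>e. e \<in> Z)" for Z
  have "neg_set {e\<in>triples n. e \<inter> D \<noteq> {}}" using neg by (auto simp: neg_set_def)
  moreover have "card Z \<le> card (triples n)" if "neg_set Z" for Z
    using that by (intro card_mono finite_triples) (simp add: neg_set_def)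
  ultimately obtain Z where Z: "neg_set Z" and Zmax: "\<And>Z'. neg_set Z' \<Longrightarrow> card Z' \<le> card Z"
    using ex_has_greatest_nat[of neg_set _ card "Suc (card (triples n))"] by (metis le_imp_less_Suc)
  have fZ: "finite Z" using Z finite_subset[OF _ finite_triples] by (auto simp: neg_set_def)
  define M where "M = triples n - Z"
  have fM: "finite M" using finite_triples by (simp add: M_def)
  \<comment> \<open>By maximality of \<open>Z\<close>, adding any missing triple completes a copy of
    \<open>H\<close>, so every triple of \<open>M\<close> is sensitive.\<close>
  have sqrtM: "sqrt (card M) \<le> 40 * real T"
  proof (rule sensitivity_bound[OF finite_triples comp, where z = "\<lambda>e. e \<in> Z"])
    show "(\<lambda>e. e \<in> Z) \<in> inputs (triples n)" using Z by (auto simp: inputs_def neg_set_def)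
    show "M \<subseteq> triples n" by (auto simp: M_def)
    fix r assume r: "r \<in> M"
    have "f_H n H (\<lambda>e. e \<in> insert r Z)"
    proof (rule ccontr)
      assume "\<not> ?thesis"
      then have "neg_set (insert r Z)" using Z r by (auto simp: neg_set_def M_def)
      from Zmax[OF this] show False using r fZ by (simp add: M_def)
    qed
    moreover have "(\<lambda>e. e \<in> Z)(r := \<not> r \<in> Z) = (\<lambda>e. e \<in> insert r Z)"
      using r by (auto simp: M_def fun_eq_iff)
    ultimately show "f_H n H ((\<lambda>e. e \<in> Z)(r := \<not> r \<in> Z)) \<noteq> f_H n H (\<lambda>e. e \<in> Z)"
      using Z by (simp add: neg_set_def)
  qed
  have deg: "N \<le> 4 * real (card {r\<in>M. a \<in> r})" if a: "a \<in> V - D" for a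
  proof (rule ccontr)
    assume "\<not> ?thesis"
    then have few: "4 * real (card {r\<in>M. a \<in> r}) < N" by simp
    \<comment> \<open>Each missing triple at \<open>a\<close> contributes two vertices, so a degree
      below N/4 gives fewer than N/2 vertices, at most \<open>card W\<close>.\<close>
    define Y where "Y = \<Union>((\<lambda>r. r - {a}) ` {r\<in>M. a \<in> r})"
    have r3: "finite r" "card r = 3" "r \<subseteq> V" "r \<inter> D = {}" if "r \<in> M" for r
      using that Z triplesD[of r n] by (auto simp: M_def neg_set_def V_def)
    have "card Y \<le> (\<Sum>r\<in>{r\<in>M. a \<in> r}. card (r - {a}))"
      unfolding Y_def using fM by (intro card_UN_le) simp
    also have "\<dots> = (\<Sum>r\<in>{r\<in>M. a \<in> r}. 2)" using r3 by (intro sum.cong) auto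
    finally have "card Y \<le> 2 * card {r\<in>M. a \<in> r}" by simp
    then have YW: "card Y \<le> card W" using few large by linarith
    define X where "X = V - D - {c}"
    define X' where "X' = V - D - {a}"
    have cV: "c \<in> V - D" and WX: "W \<subseteq> X" and DV: "D \<subseteq> V"
      using cf by (auto simp: configuration_def V_def X_def)
    have fV: "finite V" "finite X" "finite X'" by (auto simp: V_def X_def X'_def)
    have cXX: "card X = card X'" using cV a by (simp add: X_def X'_def V_def)
    have "r - {a} \<subseteq> X'" if "r \<in> M" for r using r3(3,4)[OF that] unfolding X'_def by blast
    then have "Y \<subseteq> X'" unfolding Y_def by blast
    moreover have "card W \<le> card X'" using card_mono[OF fV(2) WX] cXX by simp
    ultimately obtain Y' where Y': "Y \<subseteq> Y'" "Y' \<subseteq> X'" "card Y' = card W"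
      using exists_subset_between[OF YW _ _ fV(3)] by metis
    obtain h where h: "bij_betw h X X'" "h ` W = Y'"
      using bij_betw_extend[OF fV(2) WX fV(3) Y'(2) Y'(3)[symmetric] cXX] by blast
    \<comment> \<open>The image of \<open>W\<close> contains \<open>Y\<close>. An edge whose image
      is missing avoids \<open>D\<close>, contains \<open>c\<close> and has its other vertices sent
      into \<open>Y\<close>, so it would lie inside \<open>W \<union> {c}\<close>.\<close>
    define \<pi> where "\<pi> v = (if v \<in> D then v else if v = c then a else h v)" for v
    have "bij_betw \<pi> X X'" using h(1) by (rule bij_betw_cong[THEN iffD1, rotated]) (auto simp: \<pi>_def X_def)
    moreover have "bij_betw \<pi> (insert c D) (insert a D)"
      using cV a by (auto simp: \<pi>_def bij_betw_def inj_on_def)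
    ultimately have "bij_betw \<pi> (X \<union> insert c D) (X' \<union> insert a D)"
      by (rule bij_betw_combine) (auto simp: X'_def)
    moreover have "X \<union> insert c D = V" "X' \<union> insert a D = V" using cV a DV by (auto simp: X_def X'_def)
    ultimately have bij: "bij_betw \<pi> {..<n} {..<n}" by (simp add: V_def)
    have inj: "inj_on \<pi> V" using bij by (auto simp: bij_betw_def V_def)
    have "\<pi> ` e \<in> Z" if e: "e \<in> H" for e
    proof (rule ccontr)
      assume notZ: "\<pi> ` e \<notin> Z"
      have e3: "e \<subseteq> V" "card e = 3" using H e by (auto simp: triples_def V_def)
      have tri: "\<pi> ` e \<in> triples n"
        using e3 card_image[OF inj_on_subset[OF inj e3(1)]] bij
        by (auto simp: triples_def V_def bij_betw_def)
      then have M: "\<pi> ` e \<in> M" using notZ by (simp add: M_def)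
      have nD: "e \<inter> D = {}"
      proof (rule ccontr)
        assume "e \<inter> D \<noteq> {}"
        then obtain v where "v \<in> e" "v \<in> D" by auto
        then have "v \<in> \<pi> ` e \<inter> D" by (auto simp: \<pi>_def image_iff intro!: bexI[of _ v])
        then show False using r3(4)[OF M] by auto
      qed
      then have ce: "c \<in> e" and ne: "\<not> e \<subseteq> W \<union> {c}" using cf e by (auto simp: configuration_def)
      then obtain v where v: "v \<in> e" "v \<notin> W" "v \<noteq> c" by auto
      have "\<pi> c = a" using cV by (simp add: \<pi>_def)
      then have ae: "a \<in> \<pi> ` e" using ce by auto
      have "\<pi> v \<noteq> a" using inj_onD[OF inj, of v c] v cV e3(1) \<open>\<pi> c = a\<close> by auto
      then have "\<pi> v \<in> Y" unfolding Y_def using M ae v(1) by blast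
      then have "\<pi> v \<in> h ` W" using Y'(1) h(2) by auto
      then obtain u where u: "u \<in> W" "\<pi> v = h u" by auto
      have "h u = \<pi> u" using u(1) WX by (auto simp: \<pi>_def X_def)
      then have "v = u" using inj_onD[OF inj, of v u] u v e3(1) WX by (auto simp: X_def)
      then show False using u v by simp
    qed
    then have "f_H n H (\<lambda>e. e \<in> Z)" unfolding f_H_def using bij by blast
    then show False using Z by (simp add: neg_set_def)
  qed
  have cVD: "real (card (V - D)) = N + 1"
  proof -
    have "D \<subseteq> V" "c \<in> V - D" "finite D"
      using cf configuration_finite[OF cf] by (auto simp: configuration_def V_def)
    moreover from this have "card (V - D) > 0" by (auto simp: V_def card_gt_0_iff)
    ultimately have "card (V - D) = n - card D" "card (V - D) > 0"
      by (simp_all add: V_def card_Diff_subset)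
    then show "real (card (V - D)) = N + 1" using N by auto
  qed
  \<comment> \<open>Summing degrees over the N + 1 vertices outside \<open>D\<close> gives N^2 \<le>
    12 \<open>card M\<close>, slightly more than needed for the square (N/4)^2.\<close>
  have "N * N \<le> card (V - D) * N" unfolding cVD using N by (intro mult_right_mono) simp_all
  also have "\<dots> = (\<Sum>a\<in>V - D. N)" by simp
  also have "\<dots> \<le> (\<Sum>a\<in>V - D. 4 * real (card {r\<in>M. a \<in> r}))" by (intro sum_mono deg)
  also have "\<dots> = 4 * real (\<Sum>a\<in>V - D. card {r\<in>M. a \<in> r})" by (simp add: sum_distrib_left)
  also have "\<dots> \<le> 12 * real (card M)"
  proof -
    have "(\<Sum>a\<in>V - D. card {r\<in>M. a \<in> r}) \<le> 3 * card M"
      by (rule sum_degrees_le[of _ n]) (auto simp: M_def V_def)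
    then show ?thesis by linarith
  qed
  finally have "(N / 4)\<^sup>2 \<le> real (card M)" by (simp add: power2_eq_square)
  then have "N / 4 \<le> sqrt (card M)" by (rule real_le_rsqrt)
  then show ?thesis using sqrtM by linarith
qed

section \<open>Case distinction by the number of edges and the size of a minimum cover\<close>

lemma query_lower_bound:
  assumes H: "H \<subseteq> triples n" "H \<noteq> {}" and comp: "computes_bounded (triples n) (f_H n H) T"
  shows "real n \<le> 1280 * real T"
\<comment> \<open>768 = 4 * 192, because a cover of at most n/2 vertices leaves only N \<ge>
  n/2.\<close>
proof (cases "768 * real (card H) < (real n)\<^sup>2")
  case False
  have "sqrt (card H) \<le> 40 * real T"
  proof (rule sensitivity_bound[OF finite_triples comp, where z = "\<lambda>e. e \<in> H"])
    show "(\<lambda>e. e \<in> H) \<in> inputs (triples n)" using H by (auto simp: inputs_def)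
    fix e assume e: "e \<in> H"
    have fH: "finite H" using finite_subset[OF H(1) finite_triples] .
    have "f_H n H (\<lambda>e. e \<in> H)" unfolding f_H_def by (intro exI[of _ id]) auto
    \<comment> \<open>A vertex bijection is injective on edges, so \<open>H\<close> does not fit
      into fewer edges.\<close>
    moreover have "\<not> f_H n H (\<lambda>e'. e' \<in> H - {e})"
    proof
      assume "f_H n H (\<lambda>e'. e' \<in> H - {e})"
      then obtain \<pi> where \<pi>: "bij_betw \<pi> {..<n} {..<n}" "\<forall>e'\<in>H. \<pi> ` e' \<in> H - {e}"
        unfolding f_H_def by blast
      have "inj_on ((`) \<pi>) H"
        using \<pi>(1) H(1) by (intro inj_on_subset[OF inj_on_image_Pow[of \<pi> "{..<n}"]])
          (auto simp: bij_betw_def triples_def)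
      then have "card H \<le> card (H - {e})"
        using \<pi>(2) fH by (intro card_inj_on_le[of "(`) \<pi>"]) auto
      then show False using fH e by (metis card_Diff1_less not_le)
    qed
    moreover have "(\<lambda>e. e \<in> H)(e := \<not> e \<in> H) = (\<lambda>e'. e' \<in> H - {e})"
      using e by (auto simp: fun_eq_iff)
    ultimately show "f_H n H ((\<lambda>e. e \<in> H)(e := \<not> e \<in> H)) \<noteq> f_H n H (\<lambda>e. e \<in> H)" by simp
  qed (use H in auto)
  \<comment> \<open>28^2 = 784 exceeds 768.\<close>
  moreover have "real n / 28 \<le> sqrt (card H)"
    using False by (intro real_le_rsqrt) (simp add: power_divide)
  ultimately show ?thesis by linarith
next
  case True
  define cover where "cover S \<longleftrightarrow> S \<subseteq> {..<n} \<and> (\<forall>e\<in>H. e \<inter> S \<noteq> {})" for S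
  have e3: "e \<subseteq> {..<n}" "card e = 3" if "e \<in> H" for e using that H by (auto simp: triples_def)
  have "cover {..<n}" using e3 by (fastforce simp: cover_def Int_absorb2)
  then obtain S where S: "cover S" and Smin: "\<And>S'. cover S' \<Longrightarrow> card S \<le> card S'"
    using ex_has_least_nat[of cover _ card] by blast
  have fS: "finite S" using S finite_subset by (auto simp: cover_def)
  have n0: "n > 0" using True by (cases n) auto
  show ?thesis
  proof (cases "n < 2 * card S")
    case True
    have "{} \<notin> H" using e3(2) by fastforce
    then have cf: "configuration n H {} {} {}" by (auto simp: configuration_def)
    have "real n \<le> 640 * real T"
    proof (rule small_independent_bound[OF H(1) comp cf])
      show "2 * real (card W) \<le> real n"
        if c: "configuration n H D C W" "card D = card ({} :: nat set)" "card C = card ({} :: nat set)" for D C W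
      proof -
        have DC: "D = {}" "C = {}" using c configuration_finite[OF c(1)] by auto
        \<comment> \<open>The complement of an independent set is a cover, so \<open>W\<close> has
          at most \<open>n - card S\<close> vertices, fewer than n/2.\<close>
        have "e \<inter> ({..<n} - W) \<noteq> {}" if e: "e \<in> H" for e
        proof -
          have "\<not> e \<subseteq> W" using c(1) e unfolding configuration_def DC by simp
          then obtain v where "v \<in> e" "v \<notin> W" by blast
          then show ?thesis using e3(1)[OF e] by auto
        qed
        then have "cover ({..<n} - W)" unfolding cover_def by blast
        from Smin[OF this] have "card S + card W \<le> n"
          using card_configuration_rest[OF c(1)] by (simp add: DC)
        then show ?thesis using True by linarith
      qed
    qed (use n0 \<open>768 * real (card H) < (real n)\<^sup>2\<close> in auto)
    then show ?thesis by linarith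
  next
    case False
    define N where "N = real (n - card S)"
    have Nn: "real n \<le> 2 * N" using False by (simp add: N_def)
    have "(real n)\<^sup>2 \<le> (2 * N)\<^sup>2" using Nn by (intro power_mono) auto
    then have edges: "192 * real (card H) \<le> N\<^sup>2" using True by (simp add: power_mult_distrib)
    have "S \<noteq> {}" using S H(2) by (auto simp: cover_def)
    then obtain c where c: "c \<in> S" by auto
    have cS: "card (S - {c}) = card S - 1" "card S > 0" using c fS by (auto simp: card_gt_0_iff)
    \<comment> \<open>As \<open>S\<close> is a cover, every edge avoiding \<open>S - {c}\<close>
      contains \<open>c\<close>.\<close>
    have cf: "configuration n H (S - {c}) {c} {}"
    proof -
      have "c \<in> e \<and> \<not> e \<subseteq> {c}" if "e \<in> H" "e \<inter> (S - {c}) = {}" for e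
      proof -
        have "e \<inter> S \<noteq> {}" using S that(1) by (auto simp: cover_def)
        moreover have "\<not> e \<subseteq> {c}" using e3(2)[OF that(1)] card_mono[of "{c}" e] by auto
        ultimately show ?thesis using that(2) by auto
      qed
      then show ?thesis using S c by (auto simp: configuration_def cover_def)
    qed
    have "N \<le> 640 * real T"
    proof (cases "\<forall>D C W. configuration n H D C W \<longrightarrow> card D = card (S - {c}) \<longrightarrow> card C = card {c} \<longrightarrow>
        2 * real (card W) \<le> N")
      case True
      show ?thesis
      proof (rule small_independent_bound[OF H(1) comp cf])
        show "N = real (n - card (S - {c}) - card {c})" using cS by (simp add: N_def)
      qed (use True edges Nn n0 in auto)
    next
      case False
      then obtain D C W where DCW: "configuration n H D C W" "card D = card (S - {c})" "card C = 1"
        "N < 2 * real (card W)" by force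
      obtain c' where c': "C = {c'}" using DCW(3) by (auto simp: card_1_singleton_iff)
      have "N \<le> 160 * real T"
      proof (rule large_independent_bound[OF H(1) comp DCW(1)[unfolded c']])
        show "N = real (n - card D - 1)" using cS DCW(2) by (simp add: N_def)
        show "N \<le> 2 * real (card W)" using DCW by simp
        \<comment> \<open>Otherwise the preimage of \<open>D\<close> would be a cover with fewer
          vertices than \<open>S\<close>.\<close>
        show "\<not> f_H n H (\<lambda>e. e \<in> triples n \<and> e \<inter> D \<noteq> {})"
        proof
          assume "f_H n H (\<lambda>e. e \<in> triples n \<and> e \<inter> D \<noteq> {})"
          then obtain \<pi> where \<pi>: "bij_betw \<pi> {..<n} {..<n}" "\<And>e. e \<in> H \<Longrightarrow> \<pi> ` e \<inter> D \<noteq> {}"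
            unfolding f_H_def by blast
          define S' where "S' = {v\<in>{..<n}. \<pi> v \<in> D}"
          have "cover S'"
            unfolding cover_def
          proof (intro conjI ballI)
            fix e assume e: "e \<in> H"
            then obtain v where "v \<in> e" "\<pi> v \<in> D" using \<pi>(2) by blast
            then show "e \<inter> S' \<noteq> {}" using e3(1)[OF e] by (auto simp: S'_def)
          qed (auto simp: S'_def)
          moreover have "card S' \<le> card D"
            using \<pi>(1) configuration_finite[OF DCW(1)]
            by (intro card_inj_on_le[of \<pi>]) (auto simp: S'_def bij_betw_def inj_on_def)
          ultimately show False using Smin[of S'] DCW(2) cS by linarith
        qed
      qed
      then show ?thesis by linarith
    qed
    then show ?thesis using Nn by linarith
  qed
qed

theorem theorem4:
  shows "\<exists>c::real. c > 0 \<and>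
    (\<forall>n::nat. \<forall>H::nat set set. n \<ge> 3 \<longrightarrow> H \<subseteq> triples n \<longrightarrow> H \<noteq> {} \<longrightarrow>
       real (Q (triples n) (f_H n H)) \<ge> c * real n powr (4/5))"
proof (intro exI[of _ "1/1280"] conjI allI impI)
  fix n :: nat and H :: "nat set set"
  assume n: "n \<ge> 3" and H: "H \<subseteq> triples n" "H \<noteq> {}"
  \<comment> \<open>The linear bound is stronger than the required one.\<close>
  have "real n powr (4/5) \<le> real n powr 1" using n by (intro powr_mono) auto
  also have "\<dots> \<le> 1280 * real (Q (triples n) (f_H n H))"
    using n query_lower_bound[OF H computes_bounded_Q[OF finite_triples]] by simp
  finally show "real (Q (triples n) (f_H n H)) \<ge> 1/1280 * real n powr (4/5)" by simp
qed simp

end
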